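(* The class of Peano partial cubes is closed under retracts: every retract of a Peano partial cube is a Peano partial cube.
   Context: Graphs are simple, undirected, possibly infinite. In a connected graph $G$, $I_G(x,y)$ is the set of vertices on shortest $(x,y)$-paths; $A$ is convex if $I_G(x,y)\subseteq A$ for all $x,y\in A$; $co_G$ is the convex hull and $\mathcal{I}_G(A)=\bigcup_{x,y\in A}I_G(x,y)$. A partial cube is an isometric subgraph of a (possibly infinite) hypercube. A copoint at $x$ is a convex set maximal with respect to not containing $x$; $ph(G)$ is the least $n$ with $co_G(C\cup\{x\})=\mathcal{I}^n_G(C\cup\{x\})$ for all $x$ and copoints $C$ at $x$. A Peano partial cube is a partial cube all of whose finite convex subgraphs have pre-hull number at most $1$. A contraction $f:V(G)\to V(H)$ is a map with $d_H(f(x),f(y))\le d_G(x,y)$ for all $x,y$. A retraction of $G$ onto an induced subgraph $H$ is a contraction $V(G)\to V(H)$ whose restriction to $V(H)$ is the identity; $H$ is then a retract of $G$. *)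

theory Defs
  imports Main "HOL-Library.Extended_Nat"
begin

definition graph :: "'a set \<Rightarrow> ('a \<Rightarrow> 'a \<Rightarrow> bool) \<Rightarrow> bool" where
  "graph V E \<longleftrightarrow> (\<forall>x y. E x y \<longrightarrow> x \<in> V \<and> y \<in> V) \<and> (\<forall>x y. E x y \<longrightarrow> E y x) \<and> (\<forall>x. \<not> E x x)"

fun walk :: "('a \<Rightarrow> 'a \<Rightarrow> bool) \<Rightarrow> 'a list \<Rightarrow> bool" where
  "walk E (x # y # xs) = (E x y \<and> walk E (y # xs))"
| "walk E _ = True"

text \<open>Graph distance (infinite if no path exists).\<close>
definition gdist :: "'a set \<Rightarrow> ('a \<Rightarrow> 'a \<Rightarrow> bool) \<Rightarrow> 'a \<Rightarrow> 'a \<Rightarrow> enat" where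
  "gdist V E x y = Inf {enat (length xs - 1) | xs. xs \<noteq> [] \<and> hd xs = x \<and> last xs = y \<and> set xs \<subseteq> V \<and> walk E xs}"

definition connected_graph :: "'a set \<Rightarrow> ('a \<Rightarrow> 'a \<Rightarrow> bool) \<Rightarrow> bool" where
  "connected_graph V E \<longleftrightarrow> graph V E \<and> (\<forall>x\<in>V. \<forall>y\<in>V. gdist V E x y < \<infinity>)"

definition induced :: "('a \<Rightarrow> 'a \<Rightarrow> bool) \<Rightarrow> 'a set \<Rightarrow> 'a \<Rightarrow> 'a \<Rightarrow> bool" where
  "induced E A = (\<lambda>x y. E x y \<and> x \<in> A \<and> y \<in> A)"

definition gint :: "'a set \<Rightarrow> ('a \<Rightarrow> 'a \<Rightarrow> bool) \<Rightarrow> 'a \<Rightarrow> 'a \<Rightarrow> 'a set" where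
  "gint V E x y = {z \<in> V. gdist V E x z + gdist V E z y = gdist V E x y}"

definition gconvex :: "'a set \<Rightarrow> ('a \<Rightarrow> 'a \<Rightarrow> bool) \<Rightarrow> 'a set \<Rightarrow> bool" where
  "gconvex V E A \<longleftrightarrow> A \<subseteq> V \<and> (\<forall>x\<in>A. \<forall>y\<in>A. gint V E x y \<subseteq> A)"

definition cvx_hull :: "'a set \<Rightarrow> ('a \<Rightarrow> 'a \<Rightarrow> bool) \<Rightarrow> 'a set \<Rightarrow> 'a set" where
  "cvx_hull V E A = \<Inter> {B. gconvex V E B \<and> A \<subseteq> B}"

definition Iset :: "'a set \<Rightarrow> ('a \<Rightarrow> 'a \<Rightarrow> bool) \<Rightarrow> 'a set \<Rightarrow> 'a set" where
  "Iset V E A = (\<Union>x\<in>A. \<Union>y\<in>A. gint V E x y)"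

definition copoint :: "'a set \<Rightarrow> ('a \<Rightarrow> 'a \<Rightarrow> bool) \<Rightarrow> 'a \<Rightarrow> 'a set \<Rightarrow> bool" where
  "copoint V E x C \<longleftrightarrow> gconvex V E C \<and> x \<notin> C \<and>
     (\<forall>D. gconvex V E D \<and> C \<subseteq> D \<and> x \<notin> D \<longrightarrow> D = C)"

text \<open>ph(G) \<le> n, where ph(G) is the least m with co(C \<union> {x}) = I^m(C \<union> {x})
  for all vertices x and copoints C at x.\<close>
definition ph_le :: "'a set \<Rightarrow> ('a \<Rightarrow> 'a \<Rightarrow> bool) \<Rightarrow> nat \<Rightarrow> bool" where
  "ph_le V E n \<longleftrightarrow> (\<exists>m\<le>n. \<forall>x\<in>V. \<forall>C. copoint V E x C \<longrightarrow>
      cvx_hull V E (insert x C) = (Iset V E ^^ m) (insert x C))"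

text \<open>Partial cube: isometric subgraph of a (possibly infinite) hypercube, whose
  vertices are the finite subsets of an index set and whose distance is the size of the
  symmetric difference. The index set is taken inside the type 'a set; this is no loss
  of generality (nonconstant coordinates of an isometric embedding correspond
  injectively to splits of V).\<close>
definition partial_cube :: "'a set \<Rightarrow> ('a \<Rightarrow> 'a \<Rightarrow> bool) \<Rightarrow> bool" where
  "partial_cube V E \<longleftrightarrow> connected_graph V E \<and>
     (\<exists>f :: 'a \<Rightarrow> 'a set set. (\<forall>x\<in>V. finite (f x)) \<and>
        (\<forall>x\<in>V. \<forall>y\<in>V. gdist V E x y = enat (card ((f x - f y) \<union> (f y - f x)))))"

definition peano_partial_cube :: "'a set \<Rightarrow> ('a \<Rightarrow> 'a \<Rightarrow> bool) \<Rightarrow> bool" where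
  "peano_partial_cube V E \<longleftrightarrow> partial_cube V E \<and>
     (\<forall>A. finite A \<and> gconvex V E A \<longrightarrow> ph_le A (induced E A) 1)"

definition retraction :: "'a set \<Rightarrow> ('a \<Rightarrow> 'a \<Rightarrow> bool) \<Rightarrow> 'a set \<Rightarrow> ('a \<Rightarrow> 'a) \<Rightarrow> bool" where
  "retraction V E W f \<longleftrightarrow> W \<subseteq> V \<and> (\<forall>x\<in>V. f x \<in> W) \<and>
     (\<forall>x\<in>V. \<forall>y\<in>V. gdist W (induced E W) (f x) (f y) \<le> gdist V E x y) \<and>
     (\<forall>x\<in>W. f x = x)"

end

theory Submission
  imports Defs
begin

text \<open>In coordinates, a vertex is a finite set and \<open>btw a c b\<close> says that \<open>c\<close> lies on a geodesic from \<open>a\<close> to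
  \<open>b\<close>. For a partial cube, pre-hull number at most 1 on finite convex subgraphs is equivalent to the
  Peano axiom for geodesic intervals. The axiom produces a vertex \<open>z\<close> between \<open>v\<close> and \<open>w\<close> with
  \<open>y\<close> between \<open>u\<close> and \<open>z\<close>, and the image of \<open>z\<close> under a retraction need not keep the second property. What
  saves the argument is a rigidity of Peano partial cubes: if \<open>y\<close> lies between two boundary vertices
  \<open>x\<close>, \<open>t\<close> of a half-space, both with no further boundary vertex between them and \<open>y\<close>, then there is no
  third boundary vertex between \<open>x\<close> and \<open>t\<close>, and therefore, for each \<open>u\<close> in the half-space, \<open>y\<close> is
  between \<open>u\<close> and one of \<open>x\<close>, \<open>t\<close>. A retraction cannot create boundary vertices near \<open>y\<close>, so \<open>x\<close> and \<open>t\<close> can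
  be found in the retract, and their neighbours across the cut serve as \<open>z\<close>.\<close>

section \<open>Families of finite sets as subgraphs of a hypercube\<close>

text \<open>A contraction that fixes \<open>v\<close> and \<open>w\<close> maps the interval between
  them into itself, so the first property of \<open>z\<close> survives. But it may bring
  \<open>z\<close> closer to \<open>u\<close> as well as to \<open>y\<close>, and nothing keeps
  \<open>y\<close> between \<open>u\<close> and the image. At a cut, the Peano axiom always supplies
  a boundary vertex between the two given ones that lies behind \<open>y\<close> as seen from
  \<open>u\<close>. If only the two given ones qualify and both are in the retract, no outside
  vertex has to be moved at all. This settles the axiom when its side from \<open>u\<close> to
  \<open>w\<close> ends with a single edge behind \<open>x\<close>; the general case follows by
  moving along a geodesic.

  The same rigidity is needed earlier, to get from pre-hull number to the Peano axiom. Copoints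
  control the join of a point with maximal convex sets only. The passage to arbitrary convex sets is
  an induction on finite families, in which the proper half-spaces are already known to be Peano.
  Finiteness costs nothing: the five vertices of an instance of the axiom lie in the finite convex
  set of vertices contained in the union of \<open>u\<close>, \<open>v\<close>,
  \<open>w\<close>.\<close>

definition btw :: "'b set \<Rightarrow> 'b set \<Rightarrow> 'b set \<Rightarrow> bool" where
  "btw a c b \<longleftrightarrow> (\<forall>i. (i \<in> a \<longleftrightarrow> i \<in> b) \<longrightarrow> (i \<in> c \<longleftrightarrow> i \<in> a))"

definition flip :: "'b \<Rightarrow> 'b set \<Rightarrow> 'b set" where
  "flip i a = (if i \<in> a then a - {i} else insert i a)"

definition symdif :: "'b set \<Rightarrow> 'b set \<Rightarrow> 'b set" where
  "symdif a b = {i. (i \<in> a) \<noteq> (i \<in> b)}"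

text \<open>By induction on the distance, this one-step condition says that the family induces an isometric
  subgraph of the hypercube.\<close>
definition isometric :: "'b set set \<Rightarrow> bool" where
  "isometric G \<longleftrightarrow> (\<forall>a\<in>G. finite a) \<and> (\<forall>a\<in>G. \<forall>b\<in>G. a \<noteq> b \<longrightarrow> (\<exists>i\<in>symdif a b. flip i a \<in> G))"

text \<open>The classical picture is a triangle \<open>u\<close>, \<open>v\<close>,
  \<open>w\<close>: the ray from \<open>u\<close> through \<open>y\<close> has to meet the side
  opposite to \<open>u\<close>.\<close>

definition peano :: "'b set set \<Rightarrow> bool" where
  "peano G \<longleftrightarrow> (\<forall>u\<in>G. \<forall>v\<in>G. \<forall>w\<in>G. \<forall>x\<in>G. \<forall>y\<in>G.
     btw u x w \<and> btw v y x \<longrightarrow> (\<exists>z\<in>G. btw v z w \<and> btw u y z))"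

text \<open>Usually written $U_{ab}$, for an edge $ab$ that flips coordinate \<open>e\<close>.\<close>
definition boundary :: "'b set set \<Rightarrow> 'b \<Rightarrow> bool \<Rightarrow> 'b set set" where
  "boundary G e b = {m \<in> G. (e \<in> m \<longleftrightarrow> b) \<and> flip e m \<in> G}"

text \<open>Minimality is meant for betweenness, not for distance, so one \<open>y\<close> can have
  several such vertices on the same boundary, at different distances.\<close>

definition near :: "'b set set \<Rightarrow> 'b \<Rightarrow> bool \<Rightarrow> 'b set \<Rightarrow> 'b set \<Rightarrow> bool" where
  "near G e b y m \<longleftrightarrow> m \<in> boundary G e b \<and> (\<forall>m'\<in>boundary G e b. btw y m' m \<longrightarrow> m' = m)"

lemma mem_flip [simp]: "j \<in> flip i a \<longleftrightarrow> (if j = i then i \<notin> a else j \<in> a)"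
  by (auto simp: flip_def)

lemma flip_flip [simp]: "flip i (flip i a) = a"
  by (auto simp: flip_def)

lemma mem_symdif: "i \<in> symdif a b \<longleftrightarrow> (i \<in> a) \<noteq> (i \<in> b)"
  by (simp add: symdif_def)

lemma symdif_commute: "symdif a b = symdif b a"
  by (auto simp: symdif_def)

lemma symdif_empty_iff: "symdif a b = {} \<longleftrightarrow> a = b"
  by (auto simp: symdif_def)

lemma finite_symdif: "finite a \<Longrightarrow> finite b \<Longrightarrow> finite (symdif a b)"
  by (rule finite_subset[of _ "a \<union> b"]) (auto simp: symdif_def)

lemma btw_sym: "btw a c b \<longleftrightarrow> btw b c a"
  by (auto simp: btw_def)

lemma btw_refl [simp]: "btw a a b" "btw a b b"
  by (auto simp: btw_def)

lemma btw_at: "btw a c b \<Longrightarrow> (i \<in> a \<longleftrightarrow> i \<in> b) \<longrightarrow> (i \<in> c \<longleftrightarrow> i \<in> a)"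
  by (simp add: btw_def)

lemma btwI: "(\<And>i. (i \<in> a \<longleftrightarrow> i \<in> b) \<Longrightarrow> (i \<in> c \<longleftrightarrow> i \<in> a)) \<Longrightarrow> btw a c b"
  by (simp add: btw_def)

lemma btw_symdif: "btw a c b \<Longrightarrow> symdif a c \<subseteq> symdif a b"
  unfolding btw_def symdif_def by blast

lemma btw_symdif_less:
  assumes "btw a c b" "c \<noteq> b" "finite a" "finite b"
  shows "card (symdif a c) < card (symdif a b)"
proof (rule psubset_card_mono)
  show "finite (symdif a b)" using assms by (simp add: finite_symdif)
  obtain i where "(i \<in> c) \<noteq> (i \<in> b)" using assms(2) by blast
  then have "i \<in> symdif a b" "i \<notin> symdif a c" using assms(1) by (auto simp: btw_def mem_symdif)
  then show "symdif a c \<subset> symdif a b" using btw_symdif[OF assms(1)] by blast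
qed

lemma btw_flip:
  assumes "(i \<in> a) \<noteq> (i \<in> b)"
  shows "btw a (flip i a) b" "btw b (flip i a) a"
  using assms unfolding btw_def by auto

section \<open>Geodesics and their crossings with a cut\<close>

lemma isometricD:
  assumes "isometric G" "a \<in> G" "b \<in> G" "a \<noteq> b"
  obtains i where "i \<in> symdif a b" "flip i a \<in> G"
  using assms unfolding isometric_def by blast

lemma isometric_finite: "isometric G \<Longrightarrow> a \<in> G \<Longrightarrow> finite a"
  by (auto simp: isometric_def)

lemma geodesic_flip:
  assumes "isometric G" "a \<in> G" "b \<in> G" "i \<in> symdif a b"
  shows "\<exists>c\<in>G. flip i c \<in> G \<and> btw a c b \<and> btw a (flip i c) b \<and> (i \<in> c \<longleftrightarrow> i \<in> a)"
  using assms(2,4)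
proof (induction "card (symdif a b)" arbitrary: a rule: less_induct)
  case less
  then have "a \<noteq> b" by (auto simp: mem_symdif)
  then obtain j where j: "j \<in> symdif a b" "flip j a \<in> G"
    using assms less.prems by (meson isometricD)
  show ?case
  proof (cases "j = i")
    case True
    then show ?thesis using less.prems j by (auto simp: btw_def mem_symdif intro!: bexI[of _ a])
  next
    case False
    have "btw b (flip j a) a" using j by (auto simp: btw_def mem_symdif)
    moreover have "flip j a \<noteq> a" by (metis mem_flip)
    ultimately have "card (symdif (flip j a) b) < card (symdif a b)"
      by (metis btw_symdif_less symdif_commute isometric_finite assms(1,3) less.prems(1))
    moreover have "i \<in> symdif (flip j a) b" using False less.prems by (simp add: mem_symdif)
    ultimately obtain c where c: "c \<in> G" "flip i c \<in> G" "btw (flip j a) c b" "btw (flip j a) (flip i c) b"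
       "i \<in> c \<longleftrightarrow> i \<in> flip j a"
      using less.hyps j(2) by blast
    have "btw a c b" using c(3) j(1) by (auto simp: btw_def mem_symdif split: if_splits)
    moreover have "btw a (flip i c) b" using c(4) j(1) by (auto simp: btw_def mem_symdif split: if_splits)
    ultimately show ?thesis using c False by auto
  qed
qed

lemma crossing:
  assumes "isometric G" "a \<in> G" "g \<in> G" "e \<in> a \<longleftrightarrow> b" "e \<in> g \<longleftrightarrow> \<not> b"
  obtains m where "m \<in> boundary G e b" "btw a m g" "btw a (flip e m) g"
proof -
  have "e \<in> symdif a g" using assms by (auto simp: mem_symdif)
  from geodesic_flip[OF assms(1-3) this] show thesis using that assms(4) by (auto simp: boundary_def)
qed

lemma nearest_boundary:
  assumes "isometric G" "a \<in> G" "m \<in> boundary G e b"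
  obtains m1 where "near G e b a m1" "btw a m1 m"
proof -
  have "\<exists>m1\<in>boundary G e b. btw a m1 m \<and> (\<forall>m2\<in>boundary G e b. btw a m2 m1 \<longrightarrow> m2 = m1)"
    using assms(3)
  proof (induction "card (symdif a m)" arbitrary: m rule: less_induct)
    case less
    show ?case
    proof (cases "\<forall>m2\<in>boundary G e b. btw a m2 m \<longrightarrow> m2 = m")
      case True
      then show ?thesis using less.prems by (meson btw_refl)
    next
      case False
      then obtain m2 where m2: "m2 \<in> boundary G e b" "btw a m2 m" "m2 \<noteq> m" by blast
      then have "card (symdif a m2) < card (symdif a m)"
        using assms less.prems by (intro btw_symdif_less) (auto simp: isometric_finite boundary_def)
      then obtain m1 where m1: "m1\<in>boundary G e b" "btw a m1 m2" "\<forall>m2\<in>boundary G e b. btw a m2 m1 \<longrightarrow> m2 = m1"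
        using less.hyps m2(1) by blast
      have "btw a m1 m" using m1(2) m2(2) unfolding btw_def by metis
      then show ?thesis using m1 by blast
    qed
  qed
  then show thesis using that unfolding near_def by blast
qed

section \<open>The Peano axiom at a single cut\<close>

lemma peanoD:
  assumes "peano G" "u \<in> G" "v \<in> G" "w \<in> G" "x \<in> G" "y \<in> G" "btw u x w" "btw v y x"
  obtains z where "z \<in> G" "btw v z w" "btw u y z"
  using assms unfolding peano_def by blast

text \<open>The Peano axiom is applied to \<open>u\<close> and the mates of \<open>t\<close> and
  \<open>x\<close> across \<open>e\<close>. Its vertex \<open>z\<close> lies between the two mates,
  hence across the cut, and a geodesic from \<open>y\<close> to \<open>z\<close> leaves through the
  wanted boundary vertex.\<close>

lemma opposite_boundary:
  assumes "isometric G" "peano G" "x \<in> boundary G e b" "t \<in> boundary G e b" "y \<in> G" "u \<in> G" "e \<in> u \<longleftrightarrow> b" "btw x y t"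
  obtains m where "m \<in> boundary G e b" "btw x m t" "btw u y m"
proof -
  have B: "x \<in> G" "t \<in> G" "flip e x \<in> G" "flip e t \<in> G" "e \<in> x \<longleftrightarrow> b" "e \<in> t \<longleftrightarrow> b"
    using assms by (auto simp: boundary_def)
  have ey: "e \<in> y \<longleftrightarrow> b" using assms(8) B unfolding btw_def by metis
  have "btw u x (flip e x)" using B assms(7) by (auto simp: btw_def)
  moreover have "btw (flip e t) y x" using B assms(8) ey by (auto simp: btw_def split: if_splits)
  ultimately obtain z where z: "z \<in> G" "btw (flip e t) z (flip e x)" "btw u y z"
    using peanoD[OF assms(2,6) B(4,3,1) assms(5)] by blast
  have "e \<in> z \<longleftrightarrow> \<not> b" using btw_at[OF z(2), of e] B by auto
  then obtain m where m: "m \<in> boundary G e b" "btw y m z" using crossing[OF assms(1,5) z(1) ey] by blast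
  have "btw x m t" unfolding btw_def
  proof (intro allI impI)
    fix i assume i: "i \<in> x \<longleftrightarrow> i \<in> t"
    show "i \<in> m \<longleftrightarrow> i \<in> x"
    proof (cases "i = e")
      case True then show ?thesis using m(1) B by (auto simp: boundary_def)
    next
      case False
      then have "i \<in> z \<longleftrightarrow> i \<in> x" using btw_at[OF z(2), of i] i by auto
      moreover have "i \<in> y \<longleftrightarrow> i \<in> x" using assms(8) i unfolding btw_def by metis
      ultimately show ?thesis using m(2) unfolding btw_def by metis
    qed
  qed
  moreover have "btw u y m" using z(3) m(2) unfolding btw_def by metis
  ultimately show thesis using that m(1) by blast
qed

section \<open>Two nearest boundary vertices\<close>

text \<open>The opposite corner of \<open>m\<close> in the smallest subcube containing
  \<open>x\<close> and \<open>t\<close>: the symmetric difference of \<open>m\<close>,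
  \<open>x\<close> and \<open>t\<close>.\<close>

definition antipode :: "'b set \<Rightarrow> 'b set \<Rightarrow> 'b set \<Rightarrow> 'b set" where
  "antipode x t m = {i. (i \<in> m) \<noteq> ((i \<in> x) \<noteq> (i \<in> t))}"

lemma mem_antipode: "i \<in> antipode x t m \<longleftrightarrow> (i \<in> m) \<noteq> ((i \<in> x) \<noteq> (i \<in> t))"
  by (simp add: antipode_def)

lemma btw_opposite_trans: "btw u y m \<Longrightarrow> btw y m1 m \<Longrightarrow> btw u y m1"
  unfolding btw_def by metis

lemma btw_mid: "btw x y t \<Longrightarrow> btw x m t \<Longrightarrow> btw y m1 m \<Longrightarrow> btw x m1 t"
  unfolding btw_def by metis

lemma nearD: "near G e b y m \<Longrightarrow> m' \<in> boundary G e b \<Longrightarrow> btw y m' m \<Longrightarrow> m' = m"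
  unfolding near_def by blast

lemma near_boundary: "near G e b y m \<Longrightarrow> m \<in> boundary G e b"
  unfolding near_def by blast

lemma opposite_near:
  assumes "isometric G" "peano G" "x \<in> boundary G e b" "t \<in> boundary G e b" "y \<in> G" "u \<in> G" "e \<in> u \<longleftrightarrow> b" "btw x y t"
  obtains m where "near G e b y m" "btw x m t" "btw u y m"
proof -
  obtain m where m: "m \<in> boundary G e b" "btw x m t" "btw u y m" using opposite_boundary[OF assms] .
  obtain m1 where m1: "near G e b y m1" "btw y m1 m" using nearest_boundary[OF assms(1,5) m(1)] .
  show thesis
    using that[OF m1(1) btw_mid[OF assms(8) m(2) m1(2)] btw_opposite_trans[OF m(3) m1(2)]] .
qed

text \<open>For a near \<open>m\<close>, looking from \<open>m\<close> through \<open>y\<close>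
  gives a near \<open>m'\<close> behind \<open>y\<close>. Looking from \<open>x\<close> and from
  \<open>t\<close> through \<open>y\<close> then gives boundary vertices between \<open>m\<close>
  and \<open>m'\<close>, which nearness identifies with \<open>t\<close> and \<open>x\<close>. So
  each pair spans the box of the other, and \<open>m'\<close> is the antipode. An arbitrary
  \<open>m\<close> lies between \<open>y\<close> and the antipode of a near vertex behind
  \<open>y\<close>, and therefore is that antipode.\<close>

lemma boundary_antipode:
  assumes G: "isometric G" "peano G" and xt: "near G e b y x" "near G e b y t"
    and y: "y \<in> G" "btw x y t"
    and m: "m \<in> boundary G e b" "btw x m t"
  shows "antipode x t m \<in> boundary G e b" "near G e b y m"
proof -
  note xt' = xt[THEN near_boundary]
  have near: "near G e b y (antipode x t m)" if m: "near G e b y m" "btw x m t" for m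
  proof -
    have mG: "m \<in> G" "e \<in> m \<longleftrightarrow> b" and xG: "x \<in> G" "e \<in> x \<longleftrightarrow> b" and tG: "t \<in> G" "e \<in> t \<longleftrightarrow> b"
      using m xt by (auto simp: boundary_def near_def)
    obtain m' where m': "near G e b y m'" "btw x m' t" "btw m y m'"
      using opposite_near[OF G xt' y(1) mG y(2)] .
    note bd = near_boundary[OF m(1)] near_boundary[OF m'(1)]
    obtain x' where x': "x' \<in> boundary G e b" "btw m x' m'" "btw x y x'"
      using opposite_boundary[OF G bd y(1) xG m'(3)] .
    have "btw y x' t"
    proof (rule btwI)
      fix i assume "i \<in> y \<longleftrightarrow> i \<in> t"
      then show "i \<in> x' \<longleftrightarrow> i \<in> y"
        using btw_at[OF x'(2), of i] btw_at[OF x'(3), of i] btw_at[OF m(2), of i] btw_at[OF m'(2), of i] by argo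
    qed
    then have x't: "x' = t" using nearD xt(2) x'(1) by metis
    obtain t' where t': "t' \<in> boundary G e b" "btw m t' m'" "btw t y t'"
      using opposite_boundary[OF G bd y(1) tG m'(3)] .
    have "btw y t' x"
    proof (rule btwI)
      fix i assume "i \<in> y \<longleftrightarrow> i \<in> x"
      then show "i \<in> t' \<longleftrightarrow> i \<in> y"
        using btw_at[OF t'(2), of i] btw_at[OF t'(3), of i] btw_at[OF m(2), of i] btw_at[OF m'(2), of i] by argo
    qed
    then have t'x: "t' = x" using nearD xt(1) t'(1) by metis
    have "m' = antipode x t m"
    proof (rule set_eqI)
      fix i show "i \<in> m' \<longleftrightarrow> i \<in> antipode x t m"
        using btw_at[OF t'(2), of i] btw_at[OF x'(2), of i] btw_at[OF m(2), of i] btw_at[OF m'(2), of i]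
        unfolding t'x x't mem_antipode by argo
    qed
    then show ?thesis using m' by blast
  qed
  have mG: "m \<in> G" "e \<in> m \<longleftrightarrow> b" using m by (auto simp: boundary_def)
  obtain m1 where m1: "near G e b y m1" "btw x m1 t" "btw m y m1"
    using opposite_near[OF G xt' y(1) mG y(2)] .
  have n1: "near G e b y (antipode x t m1)"
    using near[OF m1(1,2)] .
  have "btw y m (antipode x t m1)"
  proof (rule btwI)
    fix i assume "i \<in> y \<longleftrightarrow> i \<in> antipode x t m1"
    then show "i \<in> m \<longleftrightarrow> i \<in> y"
      using btw_at[OF m1(3), of i] btw_at[OF m(2), of i] btw_at[OF y(2), of i] btw_at[OF m1(2), of i]
      unfolding mem_antipode by argo
  qed
  then have m_eq: "m = antipode x t m1" using nearD n1 m(1) by metis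
  then show "near G e b y m" using n1 by simp
  have "antipode x t m = m1" using m_eq by (auto simp: mem_antipode)
  then show "antipode x t m \<in> boundary G e b" using near_boundary[OF m1(1)] by simp
qed

lemma eq_or_eq_flip:
  assumes "\<And>i. i \<noteq> k \<Longrightarrow> i \<in> a \<longleftrightarrow> i \<in> b"
  shows "a = b \<or> a = flip k b"
proof (cases "k \<in> a \<longleftrightarrow> k \<in> b")
  case True
  then have "i \<in> a \<longleftrightarrow> i \<in> b" for i using assms[of i] by (cases "i = k") blast+
  then show ?thesis by blast
next
  case False
  then have "i \<in> a \<longleftrightarrow> i \<in> flip k b" for i using assms[of i] by (cases "i = k") auto
  then show ?thesis by blast
qed

text \<open>Of two adjacent vertices, the one that agrees with \<open>y\<close> at the flipped
  coordinate lies between \<open>y\<close> and the other.\<close>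

lemma near_not_adjacent:
  assumes "near G e b y m" "near G e b y (flip d m)"
  shows False
proof -
  have "m \<noteq> flip d m" by (metis mem_flip)
  moreover have "btw y m (flip d m) \<or> btw y (flip d m) m"
    by (cases "d \<in> y \<longleftrightarrow> d \<in> m") (auto simp: btw_def)
  ultimately show False
    using nearD[OF assms(1) near_boundary[OF assms(2)]] nearD[OF assms(2) near_boundary[OF assms(1)]] by metis
qed

text \<open>Otherwise choose a closest pair \<open>x\<close>, \<open>r\<close> of boundary vertices, with antipodes \<open>t\<close>, \<open>s\<close> in the
  box between \<open>x\<close> and \<open>t\<close>. Every boundary vertex in the box agrees with \<open>x\<close> or with \<open>r\<close> on the coordinates
  where these two differ (\<open>F2\<close>), and minimality of the box forces it to be \<open>x\<close>, \<open>r\<close>, \<open>s\<close> or \<open>t\<close>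
  (\<open>all_t\<close>). The Peano axiom, applied to vertices \<open>u\<close>, \<open>v\<close>, \<open>w\<close> across the cut, then yields a vertex
  \<open>z\<close> that is possible on neither side of \<open>e\<close>.\<close>
lemma no_third_boundary:
  assumes G: "isometric G" "peano G" and xt: "near G e b y x" "near G e b y t"
    and y: "y \<in> G" "btw x y t"
    and r: "r \<in> boundary G e b" "btw x r t" "r \<noteq> x" "r \<noteq> t"
    and closest: "\<And>m m'. m \<in> boundary G e b \<Longrightarrow> btw x m t \<Longrightarrow> m' \<in> boundary G e b \<Longrightarrow> btw x m' t \<Longrightarrow> m \<noteq> m'
      \<Longrightarrow> card (symdif x r) \<le> card (symdif m m')"
    and smaller: "\<And>x' t' y' m. near G e b y' x' \<Longrightarrow> near G e b y' t' \<Longrightarrow> y' \<in> G \<Longrightarrow> btw x' y' t'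
      \<Longrightarrow> card (symdif x' t') < card (symdif x t) \<Longrightarrow> m \<in> boundary G e b \<Longrightarrow> btw x' m t' \<Longrightarrow> m = x' \<or> m = t'"
  shows False
proof -
  define M where "M = {m \<in> boundary G e b. btw x m t}"
  have antiM: "antipode x t m \<in> M" and nearM: "near G e b y m" if "m \<in> M" for m
    using boundary_antipode[OF G xt y] that by (auto simp: M_def btw_def mem_antipode)
  have MD: "m \<in> boundary G e b" "m \<in> G" "e \<in> m \<longleftrightarrow> b" "flip e m \<in> G" "btw x m t" "finite m" if "m \<in> M" for m
    using that G by (auto simp: M_def boundary_def isometric_finite)
  define s where "s = antipode x t r"
  have xM: "x \<in> M" and tM: "t \<in> M" and rM: "r \<in> M"
    using xt r by (auto simp: M_def near_boundary)
  have sM: "s \<in> M" using antiM[OF rM] by (simp add: s_def)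
  have ms: "i \<in> s \<longleftrightarrow> (i \<in> r) \<noteq> ((i \<in> x) \<noteq> (i \<in> t))" for i by (simp add: s_def mem_antipode)
  note rb = btw_at[OF r(2)]
  have closest_pair: "m = x \<or> m = r" if m: "m \<in> boundary G e b" "btw x m r" for m
  proof (rule ccontr)
    assume c: "\<not> (m = x \<or> m = r)"
    have "btw x m t"
    proof (rule btwI)
      fix i assume "i \<in> x \<longleftrightarrow> i \<in> t"
      then show "i \<in> m \<longleftrightarrow> i \<in> x" using btw_at[OF m(2), of i] rb[of i] by argo
    qed
    then have mM: "m \<in> M" using m by (simp add: M_def)
    have "card (symdif x m) < card (symdif x r)"
      using m(2) c MD(6) mM xM rM by (intro btw_symdif_less) auto
    moreover have "card (symdif x r) \<le> card (symdif x m)"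
      using closest[of x m] MD(1,5) xM mM c by auto
    ultimately show False by simp
  qed
  \<comment> \<open>\<open>d\<close> is the coordinate of a first step from \<open>x\<close> towards
    \<open>r\<close>, and \<open>p\<close> the vertex reached. A second coordinate \<open>j\<close>
    separating \<open>x\<close> from \<open>r\<close> exists because near vertices are not
    adjacent.\<close>
  obtain d where d: "(d \<in> x) \<noteq> (d \<in> r)" "flip d x \<in> G"
    using isometricD[OF G(1) MD(2)[OF xM] MD(2)[OF rM] r(3)[symmetric]] by (metis mem_symdif)
  define p where "p = flip d x"
  have mp: "i \<in> p \<longleftrightarrow> (i \<in> x) \<noteq> (i = d)" for i by (auto simp: p_def)
  obtain j where j: "(j \<in> x) \<noteq> (j \<in> r)" "j \<noteq> d"
  proof -
    have "r \<noteq> flip d x" using near_not_adjacent nearM xM rM by metis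
    then obtain j where "(j \<in> r) \<noteq> (j \<in> flip d x)" by blast
    then show thesis using d that[of j] by (cases "j = d") auto
  qed
  have de: "d \<noteq> e" using d MD(3) xM rM by metis
  have pG: "p \<in> G" "e \<in> p \<longleftrightarrow> b" "btw x p r" "btw x p t"
    using d MD(3)[OF xM] de rb[of d] by (auto simp: p_def btw_def)

  \<comment> \<open>\<open>opposite_boundary\<close> for \<open>x\<close>, \<open>r\<close> and
    \<open>p\<close> has only \<open>x\<close> and \<open>r\<close> to offer. The answer
    \<open>x\<close> forces the value of \<open>r\<close> at \<open>d\<close>; the answer
    \<open>r\<close> forces agreement with \<open>x\<close> at the other coordinates separating the
    two.\<close>
  have F1: "(d \<in> u \<longleftrightarrow> d \<in> r) \<or> (\<forall>i. i \<noteq> d \<longrightarrow> (i \<in> x) \<noteq> (i \<in> r) \<longrightarrow> (i \<in> u \<longleftrightarrow> i \<in> x))"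
    if u: "u \<in> G" "e \<in> u \<longleftrightarrow> b" for u
  proof -
    obtain m where m: "m \<in> boundary G e b" "btw x m r" "btw u p m"
      using opposite_boundary[OF G MD(1)[OF xM] r(1) pG(1) u pG(3)] .
    from closest_pair[OF m(1,2)] show ?thesis
    proof
      assume "m = x"
      then show ?thesis using btw_at[OF m(3), of d] mp[of d] d by argo
    next
      assume "m = r"
      then have "(i \<in> u \<longleftrightarrow> i \<in> x)" if "i \<noteq> d" "(i \<in> x) \<noteq> (i \<in> r)" for i
        using btw_at[OF m(3), of i] mp[of i] that by argo
      then show ?thesis by blast
    qed
  qed
  \<comment> \<open>\<open>F1\<close> says nothing about vertices that agree with \<open>r\<close>
    at \<open>d\<close>; for these it is applied to the antipode.\<close>
  have F2: "(\<forall>i. (i \<in> x) \<noteq> (i \<in> r) \<longrightarrow> (i \<in> m \<longleftrightarrow> i \<in> x)) \<or> (\<forall>i. (i \<in> x) \<noteq> (i \<in> r) \<longrightarrow> (i \<in> m \<longleftrightarrow> i \<in> r))"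
    if m: "m \<in> M" for m
  proof (cases "d \<in> m \<longleftrightarrow> d \<in> r")
    case True
    then have "\<not> (d \<in> antipode x t m \<longleftrightarrow> d \<in> r)" using d rb[of d] unfolding mem_antipode by argo
    then have A: "i \<noteq> d \<Longrightarrow> (i \<in> x) \<noteq> (i \<in> r) \<Longrightarrow> (i \<in> antipode x t m \<longleftrightarrow> i \<in> x)" for i
      using F1[OF MD(2,3)[OF antiM[OF m]]] by blast
    have "i \<in> m \<longleftrightarrow> i \<in> r" if "(i \<in> x) \<noteq> (i \<in> r)" for i
    proof (cases "i = d")
      case False
      then show ?thesis using A[OF False that] that rb[of i] unfolding mem_antipode by argo
    qed (use True in simp)
    then show ?thesis by blast
  next
    case False
    then have "i \<noteq> d \<Longrightarrow> (i \<in> x) \<noteq> (i \<in> r) \<Longrightarrow> (i \<in> m \<longleftrightarrow> i \<in> x)" for i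
      using F1[OF MD(2,3)[OF m]] by blast
    then show ?thesis using False d by metis
  qed
  \<comment> \<open>\<open>O1\<close> and \<open>O2\<close> turn knowledge of \<open>M\<close> into
    restrictions on all vertices: on the side of \<open>x\<close> through the Peano axiom, across
    the cut through the crossing of a geodesic.\<close>
  have O1: "\<exists>m\<in>M. btw u q m" if "q \<in> G" "btw x q t" "u \<in> G" "e \<in> u \<longleftrightarrow> b" for u q
    using opposite_boundary[OF G MD(1)[OF xM] MD(1)[OF tM] that(1,3,4,2)] by (auto simp: M_def)
  have O2: "\<exists>m\<in>M. btw q m g" if q: "q \<in> G" "btw x q t" "e \<in> q \<longleftrightarrow> b"
      and g: "g \<in> G" "e \<in> g \<longleftrightarrow> \<not> b" "\<And>i. i \<noteq> e \<Longrightarrow> (i \<in> x \<longleftrightarrow> i \<in> t) \<Longrightarrow> (i \<in> g \<longleftrightarrow> i \<in> x)" for q g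
  proof -
    obtain m where m: "m \<in> boundary G e b" "btw q m g" using crossing[OF G(1) q(1) g(1) q(3) g(2)] .
    have "btw x m t"
    proof (rule btwI)
      fix i assume i: "i \<in> x \<longleftrightarrow> i \<in> t"
      show "i \<in> m \<longleftrightarrow> i \<in> x"
      proof (cases "i = e")
        case True
        then show ?thesis using m(1) MD(3)[OF xM] by (auto simp: boundary_def)
      next
        case False
        then show ?thesis using btw_at[OF m(2), of i] btw_at[OF q(2), of i] g(3)[OF False i] i by argo
      qed
    qed
    then show ?thesis using m by (auto simp: M_def)
  qed
  \<comment> \<open>The counterpart of \<open>F1\<close> across the cut. The condition on
    \<open>g\<close> keeps the crossing vertex in \<open>M\<close>, where \<open>F2\<close>
    applies.\<close>
  have F3: "(d \<in> g \<longleftrightarrow> d \<in> x) \<or> (\<forall>i. i \<noteq> d \<longrightarrow> (i \<in> x) \<noteq> (i \<in> r) \<longrightarrow> (i \<in> g \<longleftrightarrow> i \<in> r))"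
    if g: "g \<in> G" "e \<in> g \<longleftrightarrow> \<not> b" "\<And>i. i \<noteq> e \<Longrightarrow> (i \<in> x \<longleftrightarrow> i \<in> t) \<Longrightarrow> (i \<in> g \<longleftrightarrow> i \<in> x)" for g
  proof -
    obtain m where m: "m \<in> M" "btw p m g" using O2[OF pG(1,4,2) g] by blast
    from F2[OF m(1)] show ?thesis
    proof
      assume "\<forall>i. (i \<in> x) \<noteq> (i \<in> r) \<longrightarrow> (i \<in> m \<longleftrightarrow> i \<in> x)"
      then have "d \<in> m \<longleftrightarrow> d \<in> x" using d by blast
      then show ?thesis using btw_at[OF m(2), of d] mp[of d] by argo
    next
      assume A: "\<forall>i. (i \<in> x) \<noteq> (i \<in> r) \<longrightarrow> (i \<in> m \<longleftrightarrow> i \<in> r)"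
      have "i \<in> g \<longleftrightarrow> i \<in> r" if "i \<noteq> d" "(i \<in> x) \<noteq> (i \<in> r)" for i
        using A[rule_format, OF that(2)] btw_at[OF m(2), of i] mp[of i] that by argo
      then show ?thesis by blast
    qed
  qed

  \<comment> \<open>\<open>s\<close> and \<open>t\<close> differ exactly where \<open>x\<close> and
    \<open>r\<close> do. By \<open>F1\<close>, \<open>c\<close> agrees with \<open>x\<close> there,
    so it equals \<open>s\<close>, and \<open>p'\<close> is the neighbour of \<open>s\<close>
    parallel to \<open>p\<close>.\<close>
  obtain c where c: "c \<in> G" "flip d c \<in> G" "btw s c t" "btw s (flip d c) t" "d \<in> c \<longleftrightarrow> d \<in> s"
    using geodesic_flip[OF G(1) MD(2)[OF sM] MD(2)[OF tM], of d] ms[of d] rb[of d] d by (auto simp: mem_symdif)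
  have cD: "i \<in> c \<longleftrightarrow> i \<in> x" if "(i \<in> x) \<noteq> (i \<in> r)" for i
  proof -
    have "e \<in> c \<longleftrightarrow> b" using btw_at[OF c(3), of e] MD(3) sM tM by metis
    moreover have "\<not> (d \<in> c \<longleftrightarrow> d \<in> r)" using c(5) ms[of d] rb[of d] d by argo
    ultimately show ?thesis using F1[OF c(1)] that d by metis
  qed
  define p' where "p' = flip d c"
  have mc: "i \<in> p' \<longleftrightarrow> (i \<in> c) \<noteq> (i = d)" for i by (auto simp: p'_def)
  have mp': "((i \<in> x) \<noteq> (i \<in> r) \<longrightarrow> (i \<in> p' \<longleftrightarrow> i \<in> p)) \<and> ((i \<in> x \<longleftrightarrow> i \<in> r) \<longrightarrow> (i \<in> p' \<longleftrightarrow> i \<in> t))" for i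
  proof (cases "i = d")
    case True
    then show ?thesis using cD[of d] mp[of d] mc[of d] d(1) by blast
  next
    case False
    then show ?thesis using cD[of i] mp[of i] mc[of i] btw_at[OF c(3), of i] ms[of i] rb[of i] by argo
  qed
  have "p \<noteq> p'"
  proof
    assume eq: "p = p'"
    have "i \<in> r \<longleftrightarrow> i \<in> t" for i
    proof (cases "i = d")
      case True
      then show ?thesis using rb[of d] d(1) by blast
    next
      case False
      then show ?thesis using mp'[of i] mp[of i] rb[of i] unfolding eq by blast
    qed
    then show False using r by blast
  qed
  \<comment> \<open>\<open>p\<close> and \<open>p'\<close> differ exactly where \<open>r\<close> and
    \<open>t\<close> do, so \<open>k\<close> is such a coordinate. Thus \<open>y0\<close> is
    \<open>x\<close> with \<open>d\<close> and \<open>k\<close> changed, a new base vertex to which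
    both \<open>x\<close> and \<open>r\<close> turn out to be near.\<close>
  then obtain k where k0: "k \<in> symdif p p'" "flip k p \<in> G"
    using isometricD[OF G(1) pG(1), of p'] c(2) p'_def by blast
  have k: "k \<in> x \<longleftrightarrow> k \<in> r" "(k \<in> x) \<noteq> (k \<in> t)"
    using k0(1) mp'[of k] mp[of k] d unfolding mem_symdif by metis+
  define y0 where "y0 = flip k p"
  have kd: "k \<noteq> d" "k \<noteq> e" using k d MD(3) xM tM by metis+
  have my0: "i \<in> y0 \<longleftrightarrow> (if i = k then i \<in> t else if i = d then i \<in> r else i \<in> x)" for i
    using k d mp[of i] by (auto simp: y0_def)
  have y0: "y0 \<in> G" "e \<in> y0 \<longleftrightarrow> b" "btw x y0 t"
    using k0(2) kd de pG my0 rb[of d] d k by (auto simp: y0_def btw_def)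
  obtain l where l: "l \<in> x \<longleftrightarrow> l \<in> r" "(l \<in> x) \<noteq> (l \<in> t)" "l \<noteq> k"
  proof -
    have "s \<noteq> flip k x" using near_not_adjacent nearM xM sM by metis
    then obtain l where "(l \<in> s) \<noteq> (l \<in> flip k x)" by blast
    then show thesis using that[of l] ms[of l] rb[of l] ms[of k] rb[of k] k mem_flip[of l k x] by (cases "l = k") (simp, argo)
  qed
  have near_y0M: "m \<in> M" if "m \<in> boundary G e b" "btw y0 m m'" "m' \<in> M" for m m'
    using that btw_mid[OF y0(3) MD(5)[OF that(3)] that(2)] by (simp add: M_def)
  have near_r: "near G e b y0 r" unfolding near_def
  proof (intro conjI ballI impI r(1))
    fix m assume m: "m \<in> boundary G e b" "btw y0 m r"
    have mM: "m \<in> M" using near_y0M[OF m rM] .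
    have "d \<in> m \<longleftrightarrow> d \<in> r" using btw_at[OF m(2), of d] my0[of d] kd by auto
    then have A: "\<forall>i. (i \<in> x) \<noteq> (i \<in> r) \<longrightarrow> (i \<in> m \<longleftrightarrow> i \<in> r)" using F2[OF mM] d by metis
    have "i \<in> m \<longleftrightarrow> i \<in> r" if "i \<noteq> k" for i
      using A[rule_format, of i] btw_at[OF m(2), of i] my0[of i] that by (cases "i = d") (simp, argo)+
    then have "m = r \<or> m = flip k r" by (rule eq_or_eq_flip)
    then show "m = r" using near_not_adjacent nearM mM rM by metis
  qed
  have near_x: "near G e b y0 x" unfolding near_def
  proof (intro conjI ballI impI MD(1)[OF xM])
    fix m assume m: "m \<in> boundary G e b" "btw y0 m x"
    have mM: "m \<in> M" using near_y0M[OF m xM] .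
    have "j \<in> m \<longleftrightarrow> j \<in> x" using btw_at[OF m(2), of j] my0[of j] j k by metis
    then have A: "\<forall>i. (i \<in> x) \<noteq> (i \<in> r) \<longrightarrow> (i \<in> m \<longleftrightarrow> i \<in> x)" using F2[OF mM] j by metis
    have "i \<in> m \<longleftrightarrow> i \<in> x" if "i \<noteq> k" for i
      using A[rule_format, of i] btw_at[OF m(2), of i] my0[of i] that d by (cases "i = d") (simp, argo?)+
    then have "m = x \<or> m = flip k x" by (rule eq_or_eq_flip)
    then show "m = x" using near_not_adjacent nearM mM xM by metis
  qed
  have all_t: "i \<in> m \<longleftrightarrow> i \<in> t"
    if m: "m \<in> M" "k \<in> m \<longleftrightarrow> k \<in> t" and i: "i \<in> x \<longleftrightarrow> i \<in> r" "(i \<in> x) \<noteq> (i \<in> t)" for m i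
  proof -
    obtain m1 where m1: "near G e b y0 m1" "btw y0 m1 m" using nearest_boundary[OF G(1) y0(1) MD(1)[OF m(1)]] .
    have m1M: "m1 \<in> M" using near_y0M[OF near_boundary[OF m1(1)] m1(2) m(1)] .
    have m1k: "k \<in> m1 \<longleftrightarrow> k \<in> t" using btw_at[OF m1(2), of k] my0[of k] m(2) by auto
    \<comment> \<open>\<open>y0\<close> and \<open>a'\<close> both lie between \<open>m1\<close> and
      \<open>a\<close>. If these spanned a smaller box, \<open>smaller\<close> would make
      \<open>a'\<close> one of them; so they span the whole box, and \<open>m1\<close> is opposite
      to \<open>a\<close> throughout it.\<close>
    have key: "i \<in> m1 \<longleftrightarrow> i \<in> t" if a: "a \<in> M" "a' \<in> M" "near G e b y0 a" "k \<in> a' \<longleftrightarrow> k \<in> x" "a \<noteq> a'"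
      "\<And>i. (i \<in> x) \<noteq> (i \<in> r) \<Longrightarrow> (i \<in> m1) \<noteq> (i \<in> a)"
      "\<And>i. (i \<in> x \<longleftrightarrow> i \<in> r) \<Longrightarrow> (i \<in> a \<longleftrightarrow> i \<in> x)"
      "\<And>i. (i \<in> x \<longleftrightarrow> i \<in> r) \<Longrightarrow> (i \<in> a' \<longleftrightarrow> i \<in> x)"
      for a a'
    proof -
      have "btw m1 y0 a"
      proof (rule btwI)
        fix i assume i: "i \<in> m1 \<longleftrightarrow> i \<in> a"
        show "i \<in> y0 \<longleftrightarrow> i \<in> m1"
          using a(6)[of i] a(7)[of i] i my0[of i] m1k k d by (smt (verit))
      qed
      moreover have "btw m1 a' a"
      proof (rule btwI)
        fix i assume i: "i \<in> m1 \<longleftrightarrow> i \<in> a"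
        show "i \<in> a' \<longleftrightarrow> i \<in> m1" using a(6)[of i] a(7)[of i] a(8)[of i] i by argo
      qed
      moreover have "a' \<noteq> m1" using a(4) m1k k by metis
      ultimately have "\<not> card (symdif m1 a) < card (symdif x t)"
        using smaller[OF m1(1) a(3) y0(1)] MD(1)[OF a(2)] a(5) by metis
      moreover have "symdif m1 a \<subseteq> symdif x t"
        using btw_at[OF MD(5)[OF a(1)]] btw_at[OF MD(5)[OF m1M]] unfolding symdif_def by blast
      moreover have "finite (symdif x t)" using MD(6) xM tM by (simp add: finite_symdif)
      ultimately have "symdif m1 a = symdif x t" by (metis psubset_card_mono psubsetI)
      then have "(i \<in> m1) \<noteq> (i \<in> a)" using i by (metis mem_symdif)
      then show ?thesis using a(7)[OF i(1)] i by argo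
    qed
    have m1i: "i \<in> m1 \<longleftrightarrow> i \<in> t"
      using F2[OF m(1)]
    proof
      assume A: "\<forall>i. (i \<in> x) \<noteq> (i \<in> r) \<longrightarrow> (i \<in> m \<longleftrightarrow> i \<in> x)"
      have "j \<in> m1 \<longleftrightarrow> j \<in> x" using btw_at[OF m1(2), of j] my0[of j] A j k by metis
      then have "\<forall>i. (i \<in> x) \<noteq> (i \<in> r) \<longrightarrow> (i \<in> m1 \<longleftrightarrow> i \<in> x)" using F2[OF m1M] j by metis
      then show ?thesis using key[OF rM xM near_r] r(3) by blast
    next
      assume A: "\<forall>i. (i \<in> x) \<noteq> (i \<in> r) \<longrightarrow> (i \<in> m \<longleftrightarrow> i \<in> r)"
      have "d \<in> m1 \<longleftrightarrow> d \<in> r" using btw_at[OF m1(2), of d] my0[of d] A d k by metis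
      then have "\<forall>i. (i \<in> x) \<noteq> (i \<in> r) \<longrightarrow> (i \<in> m1 \<longleftrightarrow> i \<in> r)" using F2[OF m1M] d by metis
      then show ?thesis using key[OF xM rM near_x] r(3) k by blast
    qed
    show ?thesis
    proof (cases "i = k")
      case False
      have "i \<noteq> d" using i d by metis
      then show ?thesis using btw_at[OF m1(2), of i] my0[of i] m1i False i by auto
    qed (use m in simp)
  qed
  \<comment> \<open>A geodesic between the mates of \<open>a\<close> and \<open>a'\<close> flips
    \<open>k\<close> right after \<open>c\<close>. From \<open>y0\<close>, the vertex
    \<open>flip k c\<close> is reached through some \<open>m\<close> with the value of
    \<open>t\<close> at \<open>k\<close>. By \<open>all_t\<close>, all other coordinates separating
    \<open>a\<close> from \<open>a'\<close> were flipped before \<open>k\<close>, so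
    \<open>c\<close> is the mate of \<open>a'\<close> with only \<open>k\<close> set back.\<close>
  have fibre: "\<exists>c\<in>G. (e \<in> c \<longleftrightarrow> \<not> b) \<and> (\<forall>i. i \<noteq> e \<longrightarrow> (i \<in> c \<longleftrightarrow> (if i = k then i \<in> x else i \<in> a')))"
    if a: "a \<in> M" "a' \<in> M" "\<And>i. (i \<in> x) \<noteq> (i \<in> r) \<Longrightarrow> (i \<in> a) = (i \<in> a')"
      "\<And>i. (i \<in> x \<longleftrightarrow> i \<in> r) \<Longrightarrow> (i \<in> a \<longleftrightarrow> i \<in> x)"
      "\<And>i. (i \<in> x \<longleftrightarrow> i \<in> r) \<Longrightarrow> (i \<in> a' \<longleftrightarrow> i \<in> t)" for a a'
  proof -
    have "k \<in> symdif (flip e a) (flip e a')" using kd a(4)[OF k(1)] a(5)[OF k(1)] k by (simp add: mem_symdif)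
    then obtain c where c: "c \<in> G" "flip k c \<in> G" "btw (flip e a) c (flip e a')" "btw (flip e a) (flip k c) (flip e a')"
      "k \<in> c \<longleftrightarrow> k \<in> flip e a"
      using geodesic_flip[OF G(1) MD(4)[OF a(1)] MD(4)[OF a(2)]] by blast
    have ec: "e \<in> c \<longleftrightarrow> \<not> b" using btw_at[OF c(3), of e] MD(3)[OF a(1)] MD(3)[OF a(2)] by simp
    have ci: "i \<in> c \<longleftrightarrow> i \<in> a" if "i \<noteq> e" "i \<in> a \<longleftrightarrow> i \<in> a'" for i
      using btw_at[OF c(3), of i] that by simp
    have "\<exists>m\<in>M. btw y0 m (flip k c)"
    proof (rule O2[OF y0(1,3,2) c(2)])
      show "e \<in> flip k c \<longleftrightarrow> \<not> b" using ec kd by simp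
    next
      fix i assume i: "i \<noteq> e" "i \<in> x \<longleftrightarrow> i \<in> t"
      have "i \<noteq> k" using i k by metis
      moreover have "i \<in> a \<longleftrightarrow> i \<in> x" "i \<in> a' \<longleftrightarrow> i \<in> x"
        using btw_at[OF MD(5)[OF a(1)], of i] btw_at[OF MD(5)[OF a(2)], of i] i by argo+
      ultimately show "i \<in> flip k c \<longleftrightarrow> i \<in> x" using ci[OF i(1)] by simp
    qed
    then obtain m where m: "m \<in> M" "btw y0 m (flip k c)" by blast
    have ck: "k \<in> c \<longleftrightarrow> k \<in> x" using c(5) kd a(4)[OF k(1)] by simp
    have "k \<in> m \<longleftrightarrow> k \<in> t" using btw_at[OF m(2), of k] my0[of k] ck k by simp
    note mt = all_t[OF m(1) this]
    have "i \<in> c \<longleftrightarrow> i \<in> a'" if i: "i \<noteq> k" "i \<noteq> e" for i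
    proof (cases "(i \<in> a \<longleftrightarrow> i \<in> a')")
      case True
      then show ?thesis using ci[OF i(2) True] by simp
    next
      case False
      then have O: "i \<in> x \<longleftrightarrow> i \<in> r" "(i \<in> x) \<noteq> (i \<in> t)" using a(3)[of i] a(4)[of i] a(5)[of i] by argo+
      have "i \<noteq> d" using O d by metis
      then show ?thesis using btw_at[OF m(2), of i] my0[of i] mt[OF O] i O a(5)[OF O(1)] by auto
    qed
    then show ?thesis using c(1) ec ck by auto
  qed
  obtain v where v: "v \<in> G" "e \<in> v \<longleftrightarrow> \<not> b" "\<And>i. i \<noteq> e \<Longrightarrow> (i \<in> v \<longleftrightarrow> (if i = k then i \<in> x else i \<in> s))"
  proof -
    have "(i \<in> x) = (i \<in> s)" if "(i \<in> x) \<noteq> (i \<in> r)" for i using that ms[of i] rb[of i] by argo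
    moreover have "i \<in> s \<longleftrightarrow> i \<in> t" if "(i \<in> x) = (i \<in> r)" for i using that ms[of i] rb[of i] by argo
    ultimately show thesis using fibre[OF xM sM] that by blast
  qed
  obtain w where w: "w \<in> G" "e \<in> w \<longleftrightarrow> \<not> b" "\<And>i. i \<noteq> e \<Longrightarrow> (i \<in> w \<longleftrightarrow> (if i = k then i \<in> x else i \<in> t))"
  proof -
    have "(i \<in> r) = (i \<in> t)" if "(i \<in> x) \<noteq> (i \<in> r)" for i using that rb[of i] by argo
    then show thesis using fibre[OF rM tM] that by blast
  qed
  obtain u where u: "u \<in> G" "e \<in> u \<longleftrightarrow> \<not> b" "\<And>i. i \<noteq> e \<Longrightarrow> (i \<in> u \<longleftrightarrow> (if i = d then i \<in> x else i \<in> r))"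
  proof -
    have "d \<in> symdif (flip e x) (flip e r)" using d de by (simp add: mem_symdif)
    then obtain c where c: "c \<in> G" "flip d c \<in> G" "btw (flip e x) c (flip e r)" "btw (flip e x) (flip d c) (flip e r)"
      "d \<in> c \<longleftrightarrow> d \<in> flip e x"
      using geodesic_flip[OF G(1) MD(4)[OF xM] MD(4)[OF rM]] by blast
    have ec: "e \<in> c \<longleftrightarrow> \<not> b" using btw_at[OF c(3), of e] MD(3)[OF xM] MD(3)[OF rM] by simp
    have ci: "i \<in> c \<longleftrightarrow> i \<in> x" if "i \<noteq> e" "i \<in> x \<longleftrightarrow> i \<in> r" for i
      using btw_at[OF c(3), of i] that by simp
    have cd: "d \<in> c \<longleftrightarrow> d \<in> x" using c(5) de by simp
    have "(d \<in> flip d c \<longleftrightarrow> d \<in> x) \<or> (\<forall>i. i \<noteq> d \<longrightarrow> (i \<in> x) \<noteq> (i \<in> r) \<longrightarrow> (i \<in> flip d c \<longleftrightarrow> i \<in> r))"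
    proof (rule F3[OF c(2)])
      show "e \<in> flip d c \<longleftrightarrow> \<not> b" using ec de by simp
    next
      fix i assume i: "i \<noteq> e" "i \<in> x \<longleftrightarrow> i \<in> t"
      have "i \<in> x \<longleftrightarrow> i \<in> r" using rb[of i] i by argo
      then show "i \<in> flip d c \<longleftrightarrow> i \<in> x" using ci[OF i(1)] d by auto
    qed
    then have "i \<in> c \<longleftrightarrow> i \<in> r" if "i \<noteq> d" "(i \<in> x) \<noteq> (i \<in> r)" for i
      using cd that by auto
    then show thesis using that[OF c(1) ec] cd ci by metis
  qed
  define r' where "r' = flip e r"
  have "btw u r' p"
  proof (rule btwI)
    fix i assume "i \<in> u \<longleftrightarrow> i \<in> p"
    then show "i \<in> r' \<longleftrightarrow> i \<in> u"
      using u(2) u(3)[of i] mp[of i] pG(2) d by (cases "i = e"; cases "i = d") (auto simp: r'_def)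
  qed
  moreover have "btw v w r'"
  proof (rule btwI)
    fix i assume A: "i \<in> v \<longleftrightarrow> i \<in> r'"
    show "i \<in> w \<longleftrightarrow> i \<in> v"
    proof (cases "i = e")
      case False
      then show ?thesis using A v(3)[OF False] w(3)[OF False] ms[of i] rb[of i]
        by (cases "i = k") (simp_all add: r'_def, argo)
    qed (use v w in simp)
  qed
  \<comment> \<open>Four coordinates of \<open>z\<close> are forced: at \<open>j\<close> and
    \<open>k\<close> because \<open>v\<close> and \<open>p\<close> agree there, at \<open>d\<close>
    and \<open>l\<close> because \<open>u\<close> and \<open>w\<close> differ there. They contradict
    \<open>all_t\<close> on the side of \<open>x\<close> and \<open>F3\<close> across the
    cut.\<close>
  ultimately obtain z where z: "z \<in> G" "btw v z p" "btw u w z"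
    using peanoD[OF G(2) u(1) v(1) pG(1) _ w(1)] MD(4)[OF rM] r'_def by metis
  have je: "j \<noteq> e" "l \<noteq> e" using j l MD(3) xM rM tM by metis+
  have ld: "l \<noteq> d" "j \<noteq> k" using l d j k by metis+
  have zd: "d \<in> z \<longleftrightarrow> d \<in> r"
    using btw_at[OF z(3), of d] u(3)[OF de] w(3)[OF de] kd d rb[of d] by auto
  have zj: "j \<in> z \<longleftrightarrow> j \<in> x"
    using btw_at[OF z(2), of j] v(3)[OF je(1)] mp[of j] ms[of j] rb[of j] j ld by auto
  have zk: "k \<in> z \<longleftrightarrow> k \<in> x"
    using btw_at[OF z(2), of k] v(3)[OF kd(2)] mp[of k] kd by auto
  have zl: "l \<in> z \<longleftrightarrow> l \<in> t"
    using btw_at[OF z(3), of l] u(3)[OF je(2)] w(3)[OF je(2)] l ld by auto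
  show False
  proof (cases "e \<in> z \<longleftrightarrow> b")
    case True
    then obtain m where m: "m \<in> M" "btw z y0 m" using O1[OF y0(1,3) z(1)] by blast
    have "k \<in> m \<longleftrightarrow> k \<in> t" using btw_at[OF m(2), of k] my0[of k] zk k by auto
    then have "l \<in> m \<longleftrightarrow> l \<in> t" using all_t[OF m(1)] l by blast
    then show False using btw_at[OF m(2), of l] my0[of l] zl l ld by auto
  next
    case False
    then have ez: "e \<in> z \<longleftrightarrow> \<not> b" by blast
    have "(d \<in> z \<longleftrightarrow> d \<in> x) \<or> (\<forall>i. i \<noteq> d \<longrightarrow> (i \<in> x) \<noteq> (i \<in> r) \<longrightarrow> (i \<in> z \<longleftrightarrow> i \<in> r))"
    proof (rule F3[OF z(1) ez])
      fix i assume i: "i \<noteq> e" "i \<in> x \<longleftrightarrow> i \<in> t"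
      have "i \<noteq> k" "i \<noteq> d" using i k d rb[of i] by metis+
      then have "i \<in> v \<longleftrightarrow> i \<in> x" "i \<in> p \<longleftrightarrow> i \<in> x" using v(3)[OF i(1)] mp[of i] ms[of i] rb[of i] i by auto
      then show "i \<in> z \<longleftrightarrow> i \<in> x" using btw_at[OF z(2), of i] by argo
    qed
    then show False using zd zj j d by metis
  qed
qed

section \<open>Rigidity of the interval between two nearest boundary vertices\<close>

lemma btw_outer_trans: "btw u y z \<Longrightarrow> btw u x y \<Longrightarrow> btw u x z"
  unfolding btw_def by metis

text \<open>A vertex of the box and its antipode span the same box. So one end of a closest pair may
  take the place of \<open>x\<close>, and its antipode that of \<open>t\<close>, while the induction
  on the size of the box supplies the claim for smaller boxes.\<close>

lemma boundary_interval:
  assumes G: "isometric G" "peano G"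
    and "near G e b y x" "near G e b y t" "y \<in> G" "btw x y t" "m \<in> boundary G e b" "btw x m t"
  shows "m = x \<or> m = t"
  using assms(3-)
proof (induction "card (symdif x t)" arbitrary: x t y m rule: less_induct)
  case less
  show ?case
  proof (rule ccontr)
    assume c: "\<not> (m = x \<or> m = t)"
    define P where "P = (\<lambda>(a, a'). a \<in> boundary G e b \<and> btw x a t \<and> a' \<in> boundary G e b \<and> btw x a' t \<and> a \<noteq> a')"
    have "P (x, m)" using less.prems c by (auto simp: P_def near_boundary)
    then obtain a r where ar: "P (a, r)" and
      min: "\<And>q. P q \<Longrightarrow> card (symdif a r) \<le> card (symdif (fst q) (snd q))"
      using ex_has_least_nat[of P "(x, m)" "\<lambda>q. card (symdif (fst q) (snd q))"] by auto
    have a: "a \<in> boundary G e b" "btw x a t" and r: "r \<in> boundary G e b" "btw x r t" "r \<noteq> a"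
      using ar by (auto simp: P_def)
    define t' where "t' = antipode x t a"
    note an = boundary_antipode[OF G less.prems(1-4) a]
    have t': "t' \<in> boundary G e b" "btw x t' t"
    proof -
      show "t' \<in> boundary G e b" using an(1) by (simp add: t'_def)
      show "btw x t' t"
      proof (rule btwI)
        fix i assume "i \<in> x \<longleftrightarrow> i \<in> t"
        then show "i \<in> t' \<longleftrightarrow> i \<in> x" using btw_at[OF a(2), of i] unfolding t'_def mem_antipode by argo
      qed
    qed
    have box: "btw a z t' \<longleftrightarrow> btw x z t" for z
    proof -
      have "((i \<in> a \<longleftrightarrow> i \<in> t') \<longrightarrow> (i \<in> z \<longleftrightarrow> i \<in> a)) \<longleftrightarrow> ((i \<in> x \<longleftrightarrow> i \<in> t) \<longrightarrow> (i \<in> z \<longleftrightarrow> i \<in> x))" for i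
        using btw_at[OF a(2), of i] unfolding t'_def mem_antipode by argo
      then show ?thesis unfolding btw_def by blast
    qed
    have symdif: "symdif a t' = symdif x t" by (auto simp: t'_def symdif_def mem_antipode)
    \<comment> \<open>An antipodal pair is as far apart as the box allows, but \<open>x\<close> and
      the supposed third vertex \<open>m\<close> are closer.\<close>
    have rt': "r \<noteq> t'"
    proof
      assume rt: "r = t'"
      have fin: "finite x" "finite m" "finite t"
        using less.prems G by (auto simp: near_def boundary_def isometric_finite)
      have "card (symdif x m) < card (symdif x t)" using c less.prems(6) fin by (intro btw_symdif_less) auto
      moreover have "card (symdif a r) \<le> card (symdif x m)" using min[OF \<open>P (x, m)\<close>] by simp
      ultimately show False using symdif rt by simp
    qed
    show False
    proof (rule no_third_boundary[OF G an(2) boundary_antipode(2)[OF G less.prems(1-4) t'] less.prems(3) _ r(1) _ r(3) rt'])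
      show "btw a y t'" "btw a r t'" using box less.prems(4) r by auto
    next
      fix m m' assume "m \<in> boundary G e b" "btw a m t'" "m' \<in> boundary G e b" "btw a m' t'" "m \<noteq> m'"
      then show "card (symdif a r) \<le> card (symdif m m')" using min[of "(m, m')"] box by (simp add: P_def)
    next
      fix x1 t1 y1 m
      assume "near G e b y1 x1" "near G e b y1 t1" "y1 \<in> G" "btw x1 y1 t1"
        "card (symdif x1 t1) < card (symdif a t')" "m \<in> boundary G e b" "btw x1 m t1"
      then show "m = x1 \<or> m = t1" using less.hyps[of x1 t1 y1 m] symdif by simp
    qed
  qed
qed

lemma toward_near:
  assumes "isometric G" "peano G" "near G e b y x" "near G e b y t" "y \<in> G" "btw x y t" "u \<in> G" "e \<in> u \<longleftrightarrow> b"
  shows "btw u y x \<or> btw u y t"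
proof -
  obtain m where "m \<in> boundary G e b" "btw x m t" "btw u y m"
    using opposite_boundary[OF assms(1,2) near_boundary[OF assms(3)] near_boundary[OF assms(4)] assms(5,7,8,6)] .
  then show ?thesis using boundary_interval[OF assms(1-6)] by blast
qed

text \<open>The counterpart of \<open>toward_near\<close> across the cut: a geodesic from
  \<open>y\<close> to \<open>g\<close> leaves through a boundary vertex of the box, so through
  \<open>x\<close> or \<open>t\<close>.\<close>

lemma through_near:
  assumes "isometric G" "peano G" "near G e b y x" "near G e b y t" "y \<in> G" "btw x y t"
    and g: "g \<in> G" "btw (flip e x) g (flip e t)"
  shows "btw y x g \<or> btw y t g"
proof -
  have xt: "x \<in> boundary G e b" "t \<in> boundary G e b" using assms near_boundary by metis+
  then have e: "e \<in> x \<longleftrightarrow> b" "e \<in> t \<longleftrightarrow> b" by (auto simp: boundary_def)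
  have ey: "e \<in> y \<longleftrightarrow> b" using e btw_at[OF assms(6), of e] by blast
  have eg: "e \<in> g \<longleftrightarrow> \<not> b" using e btw_at[OF g(2), of e] by simp
  obtain m where m: "m \<in> boundary G e b" "btw y m g" using crossing[OF assms(1,5) g(1) ey eg] .
  have "btw x m t"
  proof (rule btwI)
    fix i assume i: "i \<in> x \<longleftrightarrow> i \<in> t"
    show "i \<in> m \<longleftrightarrow> i \<in> x"
    proof (cases "i = e")
      case True
      then show ?thesis using m(1) e by (auto simp: boundary_def)
    next
      case False
      then have "(i \<in> x \<longleftrightarrow> i \<in> t) \<longrightarrow> (i \<in> g \<longleftrightarrow> i \<in> x)" using btw_at[OF g(2), of i] by simp
      then show ?thesis using i btw_at[OF m(2), of i] btw_at[OF assms(6), of i] by argo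
    qed
  qed
  then show ?thesis using boundary_interval[OF assms(1-6) m(1)] m(2) by blast
qed

section \<open>Pre-hull number one and join-hull commutativity\<close>

definition convex_in :: "'b set set \<Rightarrow> 'b set set \<Rightarrow> bool" where
  "convex_in G C \<longleftrightarrow> C \<subseteq> G \<and> (\<forall>a\<in>C. \<forall>b\<in>C. \<forall>c\<in>G. btw a c b \<longrightarrow> c \<in> C)"

lemma convex_inD: "convex_in G C \<Longrightarrow> a \<in> C \<Longrightarrow> b \<in> C \<Longrightarrow> c \<in> G \<Longrightarrow> btw a c b \<Longrightarrow> c \<in> C"
  unfolding convex_in_def by blast

lemma convex_in_subset: "convex_in G C \<Longrightarrow> C \<subseteq> G"
  unfolding convex_in_def by blast

lemma convex_in_self [simp]: "convex_in G G"
  unfolding convex_in_def by blast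

lemma convex_in_trans: "convex_in G A \<Longrightarrow> convex_in A C \<Longrightarrow> convex_in G C"
  unfolding convex_in_def by (meson subsetD subset_trans)

lemma convex_in_restrict: "convex_in G C \<Longrightarrow> A \<subseteq> G \<Longrightarrow> C \<subseteq> A \<Longrightarrow> convex_in A C"
  unfolding convex_in_def by blast

lemma convex_in_Int: "convex_in G C \<Longrightarrow> A \<subseteq> G \<Longrightarrow> convex_in A (C \<inter> A)"
  unfolding convex_in_def by blast

lemma half_space_convex: "convex_in G {a \<in> G. i \<in> a \<longleftrightarrow> b}"
proof -
  have "i \<in> c \<longleftrightarrow> b" if "i \<in> a \<longleftrightarrow> b" "i \<in> a' \<longleftrightarrow> b" "btw a c a'" for a a' c
    using btw_at[OF that(3), of i] that(1,2) by argo
  then show ?thesis unfolding convex_in_def by blast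
qed

lemma convex_isometric:
  assumes "isometric G" "convex_in G C"
  shows "isometric C"
  unfolding isometric_def
proof (intro conjI ballI impI)
  fix a assume "a \<in> C"
  then show "finite a" using assms by (auto simp: isometric_def convex_in_def)
next
  fix a b assume ab: "a \<in> C" "b \<in> C" "a \<noteq> b"
  then obtain i where i: "i \<in> symdif a b" "flip i a \<in> G"
    using assms by (meson isometricD convex_in_subset subsetD)
  have "btw a (flip i a) b" using i(1) unfolding mem_symdif by (rule btw_flip)
  then show "\<exists>i\<in>symdif a b. flip i a \<in> C" using convex_inD[OF assms(2) ab(1,2) i(2)] i(1) by blast
qed

lemma convex_peano:
  assumes "peano G" "convex_in G C"
  shows "peano C"
  unfolding peano_def
proof (intro ballI impI)
  fix u v w x y assume C: "u \<in> C" "v \<in> C" "w \<in> C" "x \<in> C" "y \<in> C" and b: "btw u x w \<and> btw v y x"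
  have CG: "z \<in> C \<Longrightarrow> z \<in> G" for z using convex_in_subset[OF assms(2)] by blast
  obtain z where "z \<in> G" "btw v z w" "btw u y z"
    using peanoD[OF assms(1) C[THEN CG]] b by blast
  then show "\<exists>z\<in>C. btw v z w \<and> btw u y z" using convex_inD[OF assms(2) C(2,3)] by blast
qed

text \<open>Take a vertex \<open>c\<close> of \<open>C\<close> closest to \<open>u\<close> and the
  coordinate \<open>i\<close> of a first step towards \<open>u\<close>. A vertex of \<open>C\<close>
  agreeing with \<open>u\<close> at \<open>i\<close> would put \<open>flip i c\<close>, which is
  closer to \<open>u\<close>, into \<open>C\<close> by convexity.\<close>

lemma separating_coordinate:
  assumes "isometric G" "convex_in G C" "C \<noteq> {}" "u \<in> G" "u \<notin> C"
  obtains i where "\<And>c. c \<in> C \<Longrightarrow> (i \<in> c) \<noteq> (i \<in> u)"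
proof -
  obtain c0 where "c0 \<in> C" using assms by blast
  then have "\<exists>c. c \<in> C \<and> (\<forall>a. a \<in> C \<longrightarrow> card (symdif u c) \<le> card (symdif u a))"
    using ex_has_least_nat[of "\<lambda>c. c \<in> C" c0 "\<lambda>c. card (symdif u c)"] by simp
  then obtain c where c: "c \<in> C" and min: "\<And>a. a \<in> C \<Longrightarrow> card (symdif u c) \<le> card (symdif u a)" by auto
  have cG: "c \<in> G" "c \<noteq> u" using c assms(5) convex_in_subset[OF assms(2)] by blast+
  then obtain i where i: "i \<in> symdif c u" "flip i c \<in> G" using isometricD[OF assms(1) cG(1) assms(4) cG(2)] by blast
  have "(i \<in> a) \<noteq> (i \<in> u)" if a: "a \<in> C" for a
  proof
    assume eq: "i \<in> a \<longleftrightarrow> i \<in> u"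
    have "btw c (flip i c) a" using i(1) unfolding mem_symdif eq[symmetric] by (rule btw_flip)
    then have "flip i c \<in> C" using convex_inD[OF assms(2) c a i(2)] by blast
    moreover have "card (symdif u (flip i c)) < card (symdif u c)"
    proof (rule btw_symdif_less)
      show "btw u (flip i c) c" using i(1) unfolding mem_symdif by (rule btw_flip)
      show "flip i c \<noteq> c" by (metis mem_flip)
    qed (rule isometric_finite[OF assms(1) assms(4)], rule isometric_finite[OF assms(1) cG(1)])
    ultimately show False using min[of "flip i c"] by simp
  qed
  then show thesis using that by blast
qed

section \<open>Join-hull commutativity and its relation to the Peano axiom\<close>

definition join_hull_commutative :: "'b set set \<Rightarrow> bool" where
  "join_hull_commutative G \<longleftrightarrow> (\<forall>C u y. convex_in G C \<and> C \<noteq> {} \<and> u \<in> G \<and> y \<in> G \<and>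
     (\<forall>D. convex_in G D \<and> C \<subseteq> D \<and> u \<in> D \<longrightarrow> y \<in> D) \<longrightarrow> (\<exists>c\<in>C. btw u y c))"

lemma join_hull_commutativeD:
  assumes "join_hull_commutative G" "convex_in G C" "C \<noteq> {}" "u \<in> G" "y \<in> G" "\<And>D. convex_in G D \<Longrightarrow> C \<subseteq> D \<Longrightarrow> u \<in> D \<Longrightarrow> y \<in> D"
  obtains c where "c \<in> C" "btw u y c"
  using assms unfolding join_hull_commutative_def by blast

lemma btw_singleton: "btw a c a \<longleftrightarrow> c = a"
  unfolding btw_def by blast

text \<open>Applied to a singleton, the assumption makes intervals convex. Applied to
  \<open>u\<close> and the interval from \<open>v\<close> to \<open>w\<close>, whose joint hull
  contains \<open>x\<close> and then \<open>y\<close>, it yields \<open>z\<close>.\<close>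

lemma join_hull_commutative_peano:
  assumes "join_hull_commutative G"
  shows "peano G"
  unfolding peano_def
proof (intro ballI impI)
  fix u v w x y assume G: "u \<in> G" "v \<in> G" "w \<in> G" "x \<in> G" "y \<in> G" and b: "btw u x w \<and> btw v y x"
  define C where "C = {z \<in> G. btw v z w}"
  have "convex_in G C" unfolding convex_in_def
  proof (intro conjI ballI impI)
    show "C \<subseteq> G" by (auto simp: C_def)
    fix a b c assume abc: "a \<in> C" "b \<in> C" "c \<in> G" "btw a c b"
    have "convex_in G {v}" using G by (auto simp: convex_in_def btw_singleton)
    then obtain v' where "v' \<in> {v}" "btw w c v'"
    proof (rule join_hull_commutativeD[OF assms _ _ G(3) abc(3)])
      fix D assume D: "convex_in G D" "{v} \<subseteq> D" "w \<in> D"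
      then have "a \<in> D" "b \<in> D" using abc(1,2) by (auto simp: C_def intro: convex_inD)
      then show "c \<in> D" using D abc by (meson convex_inD)
    qed auto
    then show "c \<in> C" using abc(3) by (auto simp: C_def btw_sym)
  qed
  then obtain z where "z \<in> C" "btw u y z"
  proof (rule join_hull_commutativeD[OF assms _ _ G(1,5)])
    show "C \<noteq> {}" using G by (auto simp: C_def)
    fix D assume D: "convex_in G D" "C \<subseteq> D" "u \<in> D"
    then have vw: "v \<in> D" "w \<in> D" using G by (auto simp: C_def)
    then have "x \<in> D" using D G b by (meson convex_inD)
    then show "y \<in> D" using D G b vw by (meson convex_inD)
  qed
  then show "\<exists>z\<in>G. btw v z w \<and> btw u y z" by (auto simp: C_def)
qed

definition prehull_le_1 :: "'b set set \<Rightarrow> bool" where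
  "prehull_le_1 G \<longleftrightarrow> (\<forall>u\<in>G. \<forall>C. convex_in G C \<and> u \<notin> C \<and> (\<forall>D. convex_in G D \<and> C \<subseteq> D \<and> u \<notin> D \<longrightarrow> D = C) \<longrightarrow>
     (\<forall>y\<in>G. (\<forall>D. convex_in G D \<and> insert u C \<subseteq> D \<longrightarrow> y \<in> D) \<longrightarrow> (\<exists>a\<in>insert u C. \<exists>b\<in>insert u C. btw a y b)))"

lemma hull_convex: "convex_in G {z \<in> G. \<forall>D. convex_in G D \<and> S \<subseteq> D \<longrightarrow> z \<in> D}" (is "convex_in G ?H")
proof -
  have "c \<in> ?H" if "a \<in> ?H" "b \<in> ?H" "c \<in> G" "btw a c b" for a b c
  proof (intro CollectI conjI allI impI that(3))
    fix D assume D: "convex_in G D \<and> S \<subseteq> D"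
    then have "a \<in> D" "b \<in> D" using that(1,2) by simp_all
    then show "c \<in> D" using D convex_inD that(3,4) by metis
  qed
  moreover have "?H \<subseteq> G" by (rule Collect_restrict)
  ultimately show ?thesis unfolding convex_in_def[of G ?H] by (intro conjI ballI impI)
qed

text \<open>A geodesic from \<open>K\<close> into the opposite half-space leaves the side of
  \<open>K\<close> only through a boundary vertex, and these all belong to \<open>K\<close>.\<close>

lemma half_space_Un_convex:
  assumes "isometric G" "convex_in G K" "\<And>z. z \<in> K \<Longrightarrow> e \<in> z \<longleftrightarrow> b" "boundary G e b \<subseteq> K"
  shows "convex_in G ({a \<in> G. e \<in> a \<longleftrightarrow> \<not> b} \<union> K)"
proof -
  let ?h = "{a \<in> G. e \<in> a \<longleftrightarrow> \<not> b}"
  have mixed: "c \<in> ?h \<union> K" if A: "a \<in> ?h" "a' \<in> K" "c \<in> G" "btw a c a'" for a a' c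
  proof (cases "e \<in> c \<longleftrightarrow> b")
    case True
    have aG: "a \<in> G" "e \<in> a \<longleftrightarrow> \<not> b" using A(1) by auto
    obtain m where m: "m \<in> boundary G e b" "btw c m a"
      using crossing[OF assms(1) A(3) aG(1) True aG(2)] .
    have "btw m c a'" using A(4) m(2) unfolding btw_def by metis
    moreover have "m \<in> K" using m(1) assms(4) by (rule subsetD[rotated])
    ultimately show ?thesis using convex_inD[OF assms(2) _ A(2,3)] by simp
  qed (use A in simp)
  show ?thesis unfolding convex_in_def
  proof (intro conjI ballI impI)
    show "?h \<union> K \<subseteq> G" using convex_in_subset[OF assms(2)] by blast
    fix a a' c assume A: "a \<in> ?h \<union> K" "a' \<in> ?h \<union> K" "c \<in> G" "btw a c a'"
    consider "a \<in> ?h" "a' \<in> ?h" | "a \<in> ?h" "a' \<in> K" | "a' \<in> ?h" "a \<in> K" | "a \<in> K" "a' \<in> K" using A by blast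
    then show "c \<in> ?h \<union> K"
    proof cases
      case 1
      show ?thesis using convex_inD[OF half_space_convex[of G e "\<not> b"] 1 A(3,4)] by (rule UnI1)
    next
      case 2
      show ?thesis using mixed[OF 2 A(3,4)] .
    next
      case 3
      have "btw a' c a" using A(4) by (simp add: btw_sym)
      then show ?thesis using mixed[OF 3 A(3)] by simp
    next
      case 4
      show ?thesis using convex_inD[OF assms(2) 4 A(3,4)] by (rule UnI2)
    qed
  qed
qed

lemma boundary_subset_convex:
  assumes "convex_in G D" "{a \<in> G. e \<in> a \<longleftrightarrow> \<not> b} \<subseteq> D" "z \<in> D" "e \<in> z \<longleftrightarrow> b"
  shows "boundary G e b \<subseteq> D"
proof
  fix m assume m: "m \<in> boundary G e b"
  then have "flip e m \<in> D" using assms(2) by (auto simp: boundary_def)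
  moreover have "btw z m (flip e m)" using m assms(4) by (auto simp: boundary_def btw_def)
  ultimately show "m \<in> D" using convex_inD[OF assms(1,3)] m by (auto simp: boundary_def)
qed

text \<open>In a smallest counterexample \<open>y\<close> may be taken extremal as seen from \<open>u\<close>, and \<open>C\<close> enlarged to a
  half-space \<open>h\<close>. If \<open>u\<close> is in the hull \<open>B\<close> of the boundary of the opposite half-space, then \<open>h\<close> is a
  copoint at \<open>u\<close>. Otherwise some half-space \<open>D\<close> contains \<open>h\<close> and \<open>B\<close> but not \<open>u\<close>, and \<open>D\<close> is smaller,
  hence Peano. A geodesic that runs from \<open>u\<close> to a suitable \<open>q\<close> in \<open>h\<close> and keeps the coordinates
  \<open>\<alpha>\<close>, \<open>\<beta>\<close> must enter \<open>D\<close> outside \<open>h\<close>, which contradicts \<open>toward_near\<close> in \<open>D\<close>.\<close>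
lemma prehull_join_hull_commutative:
  assumes "finite G" "isometric G" "\<And>A. convex_in G A \<Longrightarrow> prehull_le_1 A"
  shows "join_hull_commutative G"
  using assms
proof (induction "card G" arbitrary: G rule: less_induct)
  case less
  note isometric = \<open>isometric G\<close>
  have IH: "join_hull_commutative A" if "convex_in G A" "z \<in> G" "z \<notin> A" for A z
  proof (rule less.hyps)
    show "card A < card G" using that less.prems(1) by (intro psubset_card_mono) (auto simp: convex_in_def)
    show "finite A" using convex_in_subset[OF that(1)] less.prems(1) finite_subset by blast
    show "isometric A" using convex_isometric[OF isometric that(1)] .
    show "prehull_le_1 B" if "convex_in A B" for B using less.prems(3) convex_in_trans \<open>convex_in G A\<close> that by blast
  qed
  show ?case
  proof (rule ccontr)
    assume "\<not> join_hull_commutative G"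
    then obtain C u y0 where C: "convex_in G C" "C \<noteq> {}" and u: "u \<in> G" and y0: "y0 \<in> G"
      "\<And>D. convex_in G D \<Longrightarrow> C \<subseteq> D \<Longrightarrow> u \<in> D \<Longrightarrow> y0 \<in> D" and no0: "\<And>c. c \<in> C \<Longrightarrow> \<not> btw u y0 c"
      unfolding join_hull_commutative_def by blast
    \<comment> \<open>A proper convex set containing \<open>C\<close> and \<open>u\<close> would be
      join-hull commutative by induction, and would join \<open>y0\<close> to \<open>C\<close>.
      Hence the hull of \<open>C\<close> and \<open>u\<close> is all of \<open>G\<close>.\<close>
    have whole: "z \<in> D" if D: "convex_in G D" "C \<subseteq> D" "u \<in> D" and z: "z \<in> G" for D z
    proof (rule ccontr)
      assume "z \<notin> D"
      then have "join_hull_commutative D" using IH D z by blast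
      then obtain c where "c \<in> C" "btw u y0 c"
      proof (rule join_hull_commutativeD)
        show "convex_in D C" using convex_in_restrict C convex_in_subset D by metis
        show "y0 \<in> A" if "convex_in D A" "C \<subseteq> A" "u \<in> A" for A using y0 convex_in_trans D that by blast
      qed (use C D y0 in auto)
      then show False using no0 by blast
    qed
    define R where "R = {z \<in> G. btw u y0 z}"
    have "finite R" "y0 \<in> R" using less.prems(1) y0 by (auto simp: R_def)
    then obtain y where yR: "y \<in> R" and max: "\<And>z. z \<in> R \<Longrightarrow> card (symdif u z) \<le> card (symdif u y)"
      using Max_in[of "(\<lambda>z. card (symdif u z)) ` R"] Max_ge[of "(\<lambda>z. card (symdif u z)) ` R"]
      by (metis (no_types, lifting) empty_iff finite_imageI imageE image_eqI image_is_empty)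
    have y: "y \<in> G" using yR by (simp add: R_def)
    have ray: "z = y" if "z \<in> G" "btw u y z" for z
    proof (rule ccontr)
      assume "z \<noteq> y"
      then have "card (symdif u y) < card (symdif u z)"
        using that isometric u by (intro btw_symdif_less) (auto simp: isometric_finite)
      moreover have "z \<in> R" using that yR btw_outer_trans by (auto simp: R_def)
      ultimately show False using max by fastforce
    qed
    have no: "\<not> btw u y c" if "c \<in> C" for c
      using no0[OF that] yR btw_outer_trans by (auto simp: R_def)
    have "y \<notin> C" using no[of y] by auto
    then obtain e where e: "\<And>c. c \<in> C \<Longrightarrow> (e \<in> c) \<noteq> (e \<in> y)" using separating_coordinate[OF isometric C y] by metis
    define b where "b = (e \<in> y)"
    define h where "h = {a \<in> G. e \<in> a \<longleftrightarrow> \<not> b}"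
    define k where "k = {a \<in> G. e \<in> a \<longleftrightarrow> b}"
    define U where "U = boundary G e b"
    have h: "convex_in G h" and k: "convex_in G k" unfolding h_def k_def by (rule half_space_convex)+
    have Ch: "C \<subseteq> h" using e convex_in_subset[OF C(1)] by (auto simp: h_def b_def)
    have yk: "y \<in> k" "y \<notin> h" using y by (auto simp: k_def h_def b_def)
    have uk: "u \<in> k" using whole[OF h Ch _ y] yk u by (auto simp: k_def h_def)
    obtain c0 where c0: "c0 \<in> C" using C by blast
    have Uk: "U \<subseteq> k" by (auto simp: U_def k_def boundary_def)
    obtain m0 where m0: "m0 \<in> U"
      using crossing[OF isometric y, of c0 e b] Ch c0 by (auto simp: U_def h_def b_def)
    define B where "B = {z \<in> k. \<forall>D. convex_in k D \<and> U \<subseteq> D \<longrightarrow> z \<in> D}"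
    have B: "convex_in k B" "convex_in G B" using hull_convex[of k U] convex_in_trans[OF k] by (auto simp: B_def)
    have UB: "U \<subseteq> B" using Uk by (auto simp: B_def)
    have B_sub: "B \<subseteq> D" if "convex_in G D" "U \<subseteq> D" for D
    proof -
      have "convex_in k (D \<inter> k)" using convex_in_Int[OF that(1)] convex_in_subset[OF k] by blast
      then show ?thesis using that(2) Uk by (auto simp: B_def)
    qed
    have jk: "join_hull_commutative k" using IH[OF k, of c0] Ch c0 by (auto simp: h_def k_def)
    \<comment> \<open>Adding to \<open>h\<close> the hull of \<open>u\<close> and \<open>U\<close>
      gives a convex set, hence everything, so that hull contains \<open>y\<close>. The join in
      \<open>k\<close> then puts \<open>y\<close> on a geodesic from \<open>u\<close> into
      \<open>B\<close>, and by \<open>ray\<close> its end is \<open>y\<close> itself.\<close>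
    have yB: "y \<in> B"
    proof -
      define K where "K = {z \<in> k. \<forall>D. convex_in k D \<and> insert u U \<subseteq> D \<longrightarrow> z \<in> D}"
      have K: "convex_in G K" using hull_convex[of k "insert u U"] convex_in_trans[OF k] by (simp add: K_def)
      have "convex_in G (h \<union> K)" unfolding h_def
        using isometric K by (rule half_space_Un_convex) (use Uk in \<open>auto simp: K_def k_def U_def\<close>)
      then have "y \<in> h \<union> K" using whole y Ch uk by (auto simp: K_def)
      then have yK: "y \<in> K" using yk by blast
      obtain c where "c \<in> B" "btw u y c"
      proof (rule join_hull_commutativeD[OF jk B(1) _ uk yk(1)])
        show "B \<noteq> {}" using m0 UB by blast
        show "y \<in> D" if "convex_in k D" "B \<subseteq> D" "u \<in> D" for D
          using yK that UB by (auto simp: K_def)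
      qed
      then show ?thesis using ray convex_in_subset[OF B(2)] by blast
    qed
    show False
    proof (cases "u \<in> B")
      case True
      \<comment> \<open>A convex set larger than \<open>h\<close> contains \<open>U\<close>, hence
        \<open>B\<close>, hence \<open>u\<close>.\<close>
      have "D = h" if D: "convex_in G D" "h \<subseteq> D" "u \<notin> D" for D
      proof (rule ccontr)
        assume "D \<noteq> h"
        then obtain z where "z \<in> D" "z \<notin> h" using D by blast
        then have "U \<subseteq> D" using boundary_subset_convex[of G D e b z] D convex_in_subset[OF D(1)] by (auto simp: U_def h_def)
        then show False using B_sub D True by blast
      qed
      moreover have "u \<notin> h" using uk by (auto simp: h_def k_def)
      moreover have "prehull_le_1 G" using less.prems(3) by simp
      moreover have "y \<in> D" if "convex_in G D" "insert u h \<subseteq> D" for D using whole that Ch y by blast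
      ultimately obtain a a' where a: "a \<in> insert u h" "a' \<in> insert u h" "btw a y a'"
        unfolding prehull_le_1_def using u h y by metis
      have far: "\<not> btw u y c" if "c \<in> h" for c using ray[of c] that yk convex_in_subset[OF h] by blast
      have "\<not> btw u y u" using no[OF c0] by (auto simp: btw_singleton)
      then show False using a far convex_inD[OF h _ _ y a(3)] yk(2) by (metis btw_sym insertE)
    next
      case False
      define F where "F = h \<union> B"
      have F: "convex_in G F" unfolding F_def h_def
        using isometric B(2) by (rule half_space_Un_convex) (use UB in \<open>auto simp: B_def k_def U_def\<close>)
      have "u \<notin> F" using False uk by (auto simp: F_def h_def k_def)
      then obtain i where i: "\<And>c. c \<in> F \<Longrightarrow> (i \<in> c) \<noteq> (i \<in> u)"
        using separating_coordinate[OF isometric F _ u] yB by (metis F_def UnI2 empty_iff)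
      define D where "D = {a \<in> G. i \<in> a \<longleftrightarrow> i \<notin> u}"
      have D: "convex_in G D" unfolding D_def by (rule half_space_convex)
      have FD: "F \<subseteq> D" using i convex_in_subset[OF F] by (auto simp: D_def)
      have "u \<notin> D" by (auto simp: D_def)
      then have jD: "join_hull_commutative D" using IH D u by blast
      note pD = join_hull_commutative_peano[OF jD] and iD = convex_isometric[OF isometric D]
      have DG: "D \<subseteq> G" using convex_in_subset[OF D] .
      have hD: "h \<subseteq> D" "U \<subseteq> D" "y \<in> D" using FD UB yB by (auto simp: F_def)
      have bD: "boundary D e b = U"
        using hD DG by (auto simp: U_def boundary_def h_def)
      have m0D: "m0 \<in> D" "m0 \<in> k" using m0 hD Uk by auto
      have jh: "convex_in D h" using convex_in_restrict[OF h DG] hD by blast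
      \<comment> \<open>Inside \<open>D\<close>, the hull of \<open>h\<close> and \<open>m0\<close>
        contains \<open>U\<close>, hence \<open>B\<close> and \<open>y\<close>.\<close>
      obtain c where c: "c \<in> h" "btw m0 y c"
      proof (rule join_hull_commutativeD[OF jD jh _ m0D(1) hD(3)])
        show "h \<noteq> {}" using Ch c0 by blast
        fix A assume A: "convex_in D A" "h \<subseteq> A" "m0 \<in> A"
        have "U \<subseteq> A" using boundary_subset_convex[of G A e b m0] convex_in_trans[OF D A(1)] A m0D by (auto simp: U_def h_def k_def)
        then show "y \<in> A" using B_sub[OF convex_in_trans[OF D A(1)]] yB by blast
      qed
      have cy: "c \<in> D" "e \<in> y \<longleftrightarrow> b" "e \<in> c \<longleftrightarrow> \<not> b" using c hD yk by (auto simp: h_def k_def)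
      obtain s where s: "s \<in> boundary D e b" "btw y s c" using crossing[OF iD hD(3) cy] .
      obtain x where x: "near D e b y x" "btw y x m0" using nearest_boundary[OF iD hD(3)] m0 bD by metis
      obtain t where t: "near D e b y t" "btw y t s" using nearest_boundary[OF iD hD(3) s(1)] .
      have xyt: "btw x y t" using c(2) s(2) x(2) t(2) unfolding btw_def by metis
      have xU: "x \<in> U" and tU: "t \<in> U" using near_boundary x t bD by metis+
      have e': "e \<in> u \<longleftrightarrow> b" "e \<in> y \<longleftrightarrow> b" "e \<in> x \<longleftrightarrow> b" "e \<in> t \<longleftrightarrow> b"
        using uk yk xU tU Uk by (auto simp: k_def)
      have mates: "flip e x \<in> h" "flip e t \<in> h" using xU tU by (auto simp: U_def boundary_def h_def)
      \<comment> \<open>By \<open>ray\<close>, \<open>y\<close> is not between \<open>u\<close> and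
        the mate of \<open>z\<close>. A coordinate witnessing this is not \<open>e\<close>, since
        \<open>u\<close> and \<open>y\<close> are on the same side.\<close>
      have bit: "\<exists>i. i \<noteq> e \<and> (i \<in> u \<longleftrightarrow> i \<in> z) \<and> (i \<in> y) \<noteq> (i \<in> u)" if z: "z \<in> U" "flip e z \<in> h" for z
      proof -
        have "\<not> btw u y (flip e z)" using ray[of "flip e z"] z(2) yk(2) convex_in_subset[OF h] by blast
        then obtain i where "i \<in> u \<longleftrightarrow> i \<in> flip e z" "(i \<in> y) \<noteq> (i \<in> u)" unfolding btw_def by blast
        moreover from this have "i \<noteq> e" using e' by metis
        ultimately show ?thesis by (intro exI[of _ i]) simp
      qed
      obtain \<beta> where \<beta>: "\<beta> \<noteq> e" "\<beta> \<in> u \<longleftrightarrow> \<beta> \<in> x" "(\<beta> \<in> y) \<noteq> (\<beta> \<in> u)" using bit[OF xU mates(1)] by blast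
      obtain \<alpha> where \<alpha>: "\<alpha> \<noteq> e" "\<alpha> \<in> u \<longleftrightarrow> \<alpha> \<in> t" "(\<alpha> \<in> y) \<noteq> (\<alpha> \<in> u)" using bit[OF tU mates(2)] by blast
      have xt\<beta>: "(\<beta> \<in> x) \<noteq> (\<beta> \<in> t)" using btw_at[OF xyt, of \<beta>] \<beta> by blast
      have ne: "\<alpha> \<noteq> \<beta>" using xt\<beta> \<alpha> \<beta> by metis
      \<comment> \<open>\<open>q\<close> is the vertex just before \<open>\<beta>\<close> is
        flipped, so it agrees with \<open>u\<close> at \<open>\<beta>\<close>. The next vertex can
        be reached from \<open>y\<close> only through \<open>t\<close>, which gives agreement with
        \<open>u\<close> at \<open>\<alpha>\<close> as well.\<close>
      have "\<beta> \<in> symdif (flip e x) (flip e t)" using xt\<beta> \<beta>(1) by (simp add: mem_symdif)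
      then obtain q where q: "q \<in> D" "flip \<beta> q \<in> D" "btw (flip e x) q (flip e t)" "btw (flip e x) (flip \<beta> q) (flip e t)"
        "\<beta> \<in> q \<longleftrightarrow> \<beta> \<in> flip e x"
        using geodesic_flip[OF iD, of "flip e x" "flip e t" \<beta>] mates hD by blast
      have q\<beta>: "\<beta> \<in> q \<longleftrightarrow> \<beta> \<in> u" using q(5) \<beta> by simp
      have tq: "(\<beta> \<in> flip \<beta> q) \<noteq> (\<beta> \<in> q)" "\<alpha> \<in> flip \<beta> q \<longleftrightarrow> \<alpha> \<in> q" using ne by simp_all
      have "btw y x (flip \<beta> q) \<or> btw y t (flip \<beta> q)"
        using through_near[OF iD pD x(1) t(1) hD(3) xyt q(2,4)] .
      moreover have "\<not> btw y x (flip \<beta> q)" using btw_at[of y x "flip \<beta> q" \<beta>] q\<beta> \<beta> tq by blast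
      ultimately have "btw y t (flip \<beta> q)" by blast
      then have q\<alpha>: "\<alpha> \<in> q \<longleftrightarrow> \<alpha> \<in> u" using btw_at[of y t "flip \<beta> q" \<alpha>] \<alpha> tq by blast
      have eq: "e \<in> q \<longleftrightarrow> \<not> b" using btw_at[OF q(3), of e] e' by simp
      have ie: "i \<noteq> e" using i[of y] i[of c] yB c e' by (auto simp: F_def h_def)
      have qG: "q \<in> G" "i \<in> q \<longleftrightarrow> \<not> (i \<in> u)" using q(1) by (auto simp: D_def)
      obtain m where m: "m \<in> boundary G i (i \<in> u)" "btw u m q" "btw u (flip i m) q"
        using crossing[OF isometric u qG(1) refl qG(2)] .
      have mG: "m \<in> G" "flip i m \<in> D" "m \<notin> D" using m(1) by (auto simp: boundary_def D_def)
      \<comment> \<open>Entering \<open>D\<close> inside \<open>h\<close> is impossible: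
        \<open>i\<close> differs from \<open>e\<close>, so the preceding vertex \<open>m\<close>
        would be in \<open>h\<close> and thus already in \<open>D\<close>.\<close>
      have em: "e \<in> flip i m \<longleftrightarrow> b"
      proof (rule ccontr)
        assume "\<not> ?thesis"
        then have "m \<in> h" using mG ie by (auto simp: h_def)
        then show False using mG hD by blast
      qed
      have "btw (flip i m) y x \<or> btw (flip i m) y t"
        using toward_near[OF iD pD x(1) t(1) hD(3) xyt mG(2) em] .
      moreover have "\<not> btw (flip i m) y x"
        using btw_at[OF m(3), of \<beta>] btw_at[of "flip i m" y x \<beta>] q\<beta> \<beta> by blast
      moreover have "\<not> btw (flip i m) y t"
        using btw_at[OF m(3), of \<alpha>] btw_at[of "flip i m" y t \<alpha>] q\<alpha> \<alpha> by blast
      ultimately show False by blast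
    qed
  qed
qed

text \<open>In the main case the axiom is used twice: it pushes \<open>y\<close> away from
  \<open>u\<close> to the segment from \<open>q\<close> to \<open>c\<close>, and from there to the
  segment from \<open>c\<close> to \<open>c'\<close>, which lies in \<open>C\<close>.\<close>

lemma peano_join_convex:
  assumes "peano G" "convex_in G C" "u \<in> G"
  shows "convex_in G {z \<in> G. z = u \<or> (\<exists>c\<in>C. btw u z c)}"
  unfolding convex_in_def
proof (intro conjI ballI impI)
  let ?J = "{z \<in> G. z = u \<or> (\<exists>c\<in>C. btw u z c)}"
  show "?J \<subseteq> G" by blast
  have CG: "C \<subseteq> G" using convex_in_subset[OF assms(2)] .
  fix p q y assume pq: "p \<in> ?J" "q \<in> ?J" and y: "y \<in> G" "btw p y q"
  consider "p = u" "q = u" | c where "p = u" "c \<in> C" "btw u q c" | c where "q = u" "c \<in> C" "btw u p c"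
    | c c' where "c \<in> C" "btw u p c" "c' \<in> C" "btw u q c'"
    using pq by blast
  then show "y \<in> ?J"
  proof cases
    case 1
    then show ?thesis using y by (simp add: btw_singleton)
  next
    case 2
    then have "btw u y c" using y(2) unfolding btw_def by metis
    then show ?thesis using y 2 by blast
  next
    case 3
    then have "btw u y c" using y(2) unfolding btw_def by metis
    then show ?thesis using y 3 by blast
  next
    case 4
    have "btw q y p" using y by (simp add: btw_sym)
    then obtain z where z: "z \<in> G" "btw q z c" "btw u y z"
      using peanoD[OF assms(1,3) _ _ _ y(1) 4(2)] pq 4 CG by blast
    have "btw c z q" using z by (simp add: btw_sym)
    then obtain z' where z': "z' \<in> G" "btw c z' c'" "btw u z z'"
      using peanoD[OF assms(1,3) _ _ _ z(1) 4(4)] pq 4 CG by blast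
    have "z' \<in> C" using convex_inD[OF assms(2)] 4 z' by blast
    moreover have "btw u y z'" using z(3) z'(3) unfolding btw_def by metis
    ultimately show ?thesis using y by blast
  qed
qed

section \<open>Retracts of Peano families\<close>

lemma btw_card_iff:
  assumes "finite a" "finite b" "finite c"
  shows "btw a c b \<longleftrightarrow> card (symdif a c) + card (symdif c b) = card (symdif a b)"
proof -
  have fin: "finite (symdif a c)" "finite (symdif c b)" "finite (symdif a b)" using assms by (auto intro: finite_symdif)
  have sub: "symdif a b \<subseteq> symdif a c \<union> symdif c b" by (auto simp: symdif_def)
  have sum: "card (symdif a c) + card (symdif c b) = card (symdif a c \<union> symdif c b) + card (symdif a c \<inter> symdif c b)"
    by (rule card_Un_Int[OF fin(1,2)])
  have le: "card (symdif a b) \<le> card (symdif a c \<union> symdif c b)" using sub fin by (intro card_mono) auto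
  have b: "btw a c b \<longleftrightarrow> symdif a c \<inter> symdif c b = {}" unfolding btw_def symdif_def by blast
  show ?thesis
  proof
    assume A: "btw a c b"
    then have "symdif a b = symdif a c \<union> symdif c b" unfolding btw_def symdif_def by blast
    then show "card (symdif a c) + card (symdif c b) = card (symdif a b)" using sum A b by simp
  next
    assume "card (symdif a c) + card (symdif c b) = card (symdif a b)"
    then have "card (symdif a c \<inter> symdif c b) = 0" using sum le by simp
    then show "btw a c b" using b fin by simp
  qed
qed

lemma symdif_card_triangle:
  assumes "finite a" "finite b" "finite c"
  shows "card (symdif a b) \<le> card (symdif a c) + card (symdif c b)"
proof -
  have "card (symdif a b) \<le> card (symdif a c \<union> symdif c b)"
    using assms by (intro card_mono finite_UnI finite_symdif) (auto simp: symdif_def)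
  then show ?thesis using card_Un_le order_trans by blast
qed

locale family_retract =
  fixes G H :: "'b set set" and \<rho> :: "'b set \<Rightarrow> 'b set"
  assumes G: "isometric G" "peano G" and H: "H \<subseteq> G" "isometric H"
    and \<rho>H: "\<And>c. c \<in> G \<Longrightarrow> \<rho> c \<in> H" and \<rho>_id: "\<And>a. a \<in> H \<Longrightarrow> \<rho> a = a"
    and contr: "\<And>a b. a \<in> G \<Longrightarrow> b \<in> G \<Longrightarrow> card (symdif (\<rho> a) (\<rho> b)) \<le> card (symdif a b)"
begin

lemma mem_H_G: "a \<in> H \<Longrightarrow> a \<in> G"
  using H by blast

text \<open>With both ends fixed neither distance from \<open>c\<close> can shrink, since the two
  already add up to the distance of the ends.\<close>

lemma \<rho>_btw:
  assumes "a \<in> H" "b \<in> H" "c \<in> G" "btw a c b"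
  shows "btw a (\<rho> c) b" "card (symdif a (\<rho> c)) = card (symdif a c)"
proof -
  have fin: "finite a" "finite b" "finite c" "finite (\<rho> c)"
    using assms mem_H_G \<rho>H G(1) by (auto simp: isometric_finite)
  have 1: "card (symdif a (\<rho> c)) \<le> card (symdif a c)" "card (symdif (\<rho> c) b) \<le> card (symdif c b)"
    using contr[of a c] contr[of c b] assms mem_H_G \<rho>_id by auto
  have 2: "card (symdif a c) + card (symdif c b) = card (symdif a b)" using btw_card_iff[of a b c] fin assms(4) by blast
  have 3: "card (symdif a b) \<le> card (symdif a (\<rho> c)) + card (symdif (\<rho> c) b)" using symdif_card_triangle fin by blast
  show "card (symdif a (\<rho> c)) = card (symdif a c)" using 1 2 3 by linarith
  then show "btw a (\<rho> c) b" using btw_card_iff[of a b "\<rho> c"] fin 1 2 3 by linarith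
qed

text \<open>A boundary vertex of \<open>G\<close> between \<open>y\<close> and \<open>x\<close> has its mate across \<open>e\<close> retracted onto the mate of
  \<open>x\<close>, which by preservation of distances is possible only if the two mates are equal.\<close>
lemma near_G:
  assumes x: "near H e b y x" and t: "near H e b y t" and y: "y \<in> H" "btw x y t"
  shows "near G e b y x"
  unfolding near_def
proof (intro conjI ballI impI)
  have xH: "x \<in> H" "flip e x \<in> H" "e \<in> x \<longleftrightarrow> b" and tH: "t \<in> H" "flip e t \<in> H" "e \<in> t \<longleftrightarrow> b"
    using near_boundary[OF x] near_boundary[OF t] by (auto simp: boundary_def)
  then show "x \<in> boundary G e b" by (auto simp: boundary_def mem_H_G)
  have ey: "e \<in> y \<longleftrightarrow> b" using btw_at[OF y(2), of e] xH tH by blast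
  fix m assume m: "m \<in> boundary G e b" "btw y m x"
  then have em: "flip e m \<in> G" "e \<in> m \<longleftrightarrow> b" by (auto simp: boundary_def)
  \<comment> \<open>This is where \<open>t\<close> enters: lying between two mates keeps the image
    \<open>g\<close> across \<open>e\<close>, whereas lying between one mate and \<open>y\<close>
    would let it return to the side of \<open>y\<close>.\<close>
  have 1: "btw (flip e x) (flip e m) (flip e t)"
    using btw_at[OF y(2)] btw_at[OF m(2)] xH(3) tH(3) em(2) unfolding btw_def by (metis mem_flip)
  have 2: "btw (flip e x) (flip e m) y"
    using btw_at[OF m(2)] xH(3) em(2) ey unfolding btw_def by (metis mem_flip)
  define g where "g = \<rho> (flip e m)"
  have gH: "g \<in> H" using \<rho>H em by (simp add: g_def)
  have g: "btw (flip e x) g (flip e t)" "btw (flip e x) g y" "card (symdif (flip e x) g) = card (symdif (flip e x) (flip e m))"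
    using \<rho>_btw[OF xH(2) tH(2) em(1) 1] \<rho>_btw[OF xH(2) y(1) em(1) 2] by (auto simp: g_def)
  have eg: "e \<in> g \<longleftrightarrow> \<not> b" using btw_at[OF g(1), of e] xH(3) tH(3) by simp
  \<comment> \<open>The crossing vertex \<open>s\<close> lies between \<open>y\<close> and
    \<open>x\<close>, so it is \<open>x\<close>. Hence \<open>flip e x\<close> is between
    \<open>y\<close> and \<open>g\<close> while \<open>g\<close> is between \<open>flip e x\<close>
    and \<open>y\<close>, and the two coincide.\<close>
  obtain s where s: "s \<in> boundary H e b" "btw y s g" "btw y (flip e s) g"
    using crossing[OF H(2) y(1) gH ey eg] .
  have "btw y s x"
  proof (rule btwI)
    fix i assume "i \<in> y \<longleftrightarrow> i \<in> x"
    then show "i \<in> s \<longleftrightarrow> i \<in> y"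
      using btw_at[OF s(2), of i] btw_at[OF g(2), of i] s(1) ey by (cases "i = e") (auto simp: boundary_def)
  qed
  then have "s = x" using nearD[OF x s(1)] by blast
  then have "btw y (flip e x) g" using s(3) by simp
  then have "g = flip e x" using g(2) unfolding btw_def by blast
  then have "card (symdif (flip e x) (flip e m)) = 0" using g(3) by (simp add: symdif_def)
  moreover have "finite (symdif (flip e x) (flip e m))"
    using finite_symdif isometric_finite G(1) mem_H_G xH(2) em(1) by metis
  ultimately have "flip e x = flip e m" by (simp add: symdif_empty_iff)
  then show "m = x" by (metis flip_flip)
qed

text \<open>The Peano axiom for an edge from \<open>x\<close> to \<open>w\<close>. If
  \<open>w\<close> itself does not serve as \<open>z\<close>, the cut of this edge separates
  \<open>v\<close> from \<open>x\<close> and \<open>y\<close>, and the rigidity in \<open>G\<close>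
  leaves the mates of two vertices of the retract as candidates.\<close>

lemma retract_step:
  assumes mem: "u \<in> H" "v \<in> H" "flip e x \<in> H" "x \<in> H" "y \<in> H" and ux: "btw u x (flip e x)" and vy: "btw v y x"
  shows "\<exists>z\<in>H. btw v z (flip e x) \<and> btw u y z"
proof (cases "btw v y (flip e x)")
  case True
  then show ?thesis using mem by (metis btw_refl(2))
next
  case False
  then obtain j where "j \<in> v \<longleftrightarrow> j \<in> flip e x" "(j \<in> y) \<noteq> (j \<in> v)" unfolding btw_def by blast
  then have j: "e \<in> v \<longleftrightarrow> e \<notin> x" "(e \<in> y) \<noteq> (e \<in> v)"
    using btw_at[OF vy, of j] by (cases "j = e"; auto)+
  define b where "b = (e \<in> x)"
  have e: "e \<in> x \<longleftrightarrow> b" "e \<in> y \<longleftrightarrow> b" "e \<in> v \<longleftrightarrow> \<not> b" "e \<in> u \<longleftrightarrow> b"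
    using j btw_at[OF ux, of e] by (auto simp: b_def)
  have xU: "x \<in> boundary H e b" using mem e by (simp add: boundary_def)
  obtain t where t: "t \<in> boundary H e b" "btw y t v" using crossing[OF H(2) mem(5,2) e(2,3)] .
  obtain x' where x': "near H e b y x'" "btw y x' x" using nearest_boundary[OF H(2) mem(5) xU] .
  obtain t' where t': "near H e b y t'" "btw y t' t" using nearest_boundary[OF H(2) mem(5) t(1)] .
  have xyt: "btw x' y t'" using x'(2) t'(2) t(2) vy unfolding btw_def by metis
  have memb: "flip e x' \<in> H" "flip e t' \<in> H" "e \<in> x' \<longleftrightarrow> b" "e \<in> t' \<longleftrightarrow> b"
    using near_boundary[OF x'(1)] near_boundary[OF t'(1)] by (auto simp: boundary_def)
  have "btw u y x' \<or> btw u y t'"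
    using toward_near[OF G near_G[OF x'(1) t'(1) mem(5) xyt] near_G[OF t'(1) x'(1) mem(5)] _ xyt _ e(4)]
      mem_H_G mem xyt by (simp add: btw_sym)
  then show ?thesis
  proof
    assume y: "btw u y x'"
    have "btw u y (flip e x')"
      using y e memb unfolding btw_def by (metis mem_flip)
    moreover have "btw v (flip e x') (flip e x)"
    proof (rule btwI)
      fix i assume "i \<in> v \<longleftrightarrow> i \<in> flip e x"
      then show "i \<in> flip e x' \<longleftrightarrow> i \<in> v"
        using btw_at[OF vy, of i] btw_at[OF x'(2), of i] e memb by (cases "i = e") auto
    qed
    ultimately show ?thesis using memb by blast
  next
    assume y: "btw u y t'"
    have "btw u y (flip e t')"
      using y e memb unfolding btw_def by (metis mem_flip)
    moreover have "btw v (flip e t') (flip e x)"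
    proof (rule btwI)
      fix i assume "i \<in> v \<longleftrightarrow> i \<in> flip e x"
      then show "i \<in> flip e t' \<longleftrightarrow> i \<in> v"
        using btw_at[OF vy, of i] btw_at[OF t'(2), of i] btw_at[OF t(2), of i] e memb by (cases "i = e") auto
    qed
    ultimately show ?thesis using memb by blast
  qed
qed

text \<open>\<open>x\<close> moves to \<open>w\<close> one edge at a time; each edge replaces
  \<open>y\<close> by a vertex further away from \<open>u\<close>, so the betweenness relations
  compose.\<close>

lemma retract_peano: "peano H"
proof -
  have "\<exists>z\<in>H. btw v z w \<and> btw u y z"
    if "u \<in> H" "v \<in> H" "w \<in> H" "x \<in> H" "y \<in> H" "btw u x w" "btw v y x" for u v w x y
    using that
  proof (induction "card (symdif w x)" arbitrary: x y rule: less_induct)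
    case less
    show ?case
    proof (cases "x = w")
      case True
      then show ?thesis using less.prems by (metis btw_refl(2))
    next
      case False
      then obtain i where i: "i \<in> symdif x w" "flip i x \<in> H" using isometricD[OF H(2) less.prems(4,3)] by metis
      have w: "btw w (flip i x) x" using i by (auto simp: btw_def mem_symdif)
      have "flip i x \<noteq> x" by (metis mem_flip)
      then have card: "card (symdif w (flip i x)) < card (symdif w x)"
        using w less.prems H(2) by (intro btw_symdif_less) (auto simp: isometric_finite)
      have ux: "btw u x (flip i x)" "btw u (flip i x) w" using less.prems(6) w unfolding btw_def by metis+
      obtain y' where y': "y' \<in> H" "btw v y' (flip i x)" "btw u y y'"
        using retract_step[OF less.prems(1,2) i(2) less.prems(4,5) ux(1) less.prems(7)] by blast
      obtain z where z: "z \<in> H" "btw v z w" "btw u y' z"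
        using less.hyps[OF card less.prems(1-3) i(2) y'(1) ux(2) y'(2)] by blast
      have "btw u y z" using z(3) y'(3) unfolding btw_def by metis
      then show ?thesis using z by blast
    qed
  qed
  then show ?thesis unfolding peano_def by blast
qed

end

section \<open>Graphs with hypercube coordinates\<close>

text \<open>Connectedness is implicit, because all distances are finite.\<close>

definition cube_coding :: "'a set \<Rightarrow> ('a \<Rightarrow> 'a \<Rightarrow> bool) \<Rightarrow> ('a \<Rightarrow> 'b set) \<Rightarrow> bool" where
  "cube_coding S E \<phi> \<longleftrightarrow> graph S E \<and> (\<forall>x\<in>S. finite (\<phi> x)) \<and>
     (\<forall>x\<in>S. \<forall>y\<in>S. gdist S E x y = enat (card (symdif (\<phi> x) (\<phi> y))))"

lemma cube_codingD:
  assumes "cube_coding S E \<phi>"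
  shows "graph S E" "x \<in> S \<Longrightarrow> finite (\<phi> x)"
    "x \<in> S \<Longrightarrow> y \<in> S \<Longrightarrow> gdist S E x y = enat (card (symdif (\<phi> x) (\<phi> y)))"
  using assms by (auto simp: cube_coding_def)

lemma gdist_le_walk:
  assumes "xs \<noteq> []" "hd xs = x" "last xs = y" "set xs \<subseteq> S" "walk E xs"
  shows "gdist S E x y \<le> enat (length xs - 1)"
  unfolding gdist_def by (rule Inf_lower) (use assms in blast)

lemma gdist_attained:
  assumes "gdist S E x y = enat n"
  obtains xs where "xs \<noteq> []" "hd xs = x" "last xs = y" "set xs \<subseteq> S" "walk E xs" "length xs - 1 = n"
proof -
  let ?A = "{enat (length xs - 1) | xs. xs \<noteq> [] \<and> hd xs = x \<and> last xs = y \<and> set xs \<subseteq> S \<and> walk E xs}"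
  have "?A \<noteq> {}"
  proof
    assume "?A = {}"
    then have "gdist S E x y = \<infinity>" unfolding gdist_def by (simp only: Inf_enat_def) simp
    then show False using assms by simp
  qed
  then obtain a where "a \<in> ?A" by blast
  then have "Inf ?A \<in> ?A" by (rule wellorder_InfI)
  then have "enat n \<in> ?A" using assms unfolding gdist_def by simp
  then show thesis using that by auto
qed

lemma walk_Suc_Suc:
  assumes "length xs = Suc (Suc n)"
  obtains x y zs where "xs = x # y # zs" "length zs = n"
  using assms by (metis length_Suc_conv)

lemma cube_coding_inj:
  assumes "cube_coding S E \<phi>" "x \<in> S" "y \<in> S" "\<phi> x = \<phi> y"
  shows "x = y"
proof -
  have "gdist S E x y = enat 0" using cube_codingD(3)[OF assms(1-3)] assms(4) by (simp add: symdif_def)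
  then obtain xs where "xs \<noteq> []" "hd xs = x" "last xs = y" "length xs - 1 = 0" by (rule gdist_attained)
  then show ?thesis by (cases xs) auto
qed

lemma cube_coding_inj_on: "cube_coding S E \<phi> \<Longrightarrow> inj_on \<phi> S"
  by (auto intro: inj_onI cube_coding_inj)

lemma symdif_card_1:
  assumes "card (symdif a b) = 1"
  obtains i where "b = flip i a" "i \<in> symdif a b"
proof -
  obtain i where i: "symdif a b = {i}" using assms by (auto simp: card_1_singleton_iff)
  then have "(j \<in> a) \<noteq> (j \<in> b) \<longleftrightarrow> j = i" for j unfolding symdif_def by blast
  then have "j \<in> b \<longleftrightarrow> j \<in> flip i a" for j unfolding mem_flip by metis
  then show thesis using that i by blast
qed

lemma cube_coding_step:
  assumes R: "cube_coding S E \<phi>" and x: "x \<in> S" and E: "E x z" "z \<in> S"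
  obtains i where "\<phi> z = flip i (\<phi> x)" "i \<in> symdif (\<phi> x) (\<phi> z)"
proof -
  have "x \<noteq> z" using cube_codingD(1)[OF R] E(1) by (auto simp: graph_def)
  then have "\<phi> x \<noteq> \<phi> z" using cube_coding_inj[OF R x E(2)] by blast
  then have pos: "card (symdif (\<phi> x) (\<phi> z)) \<noteq> 0"
    using finite_symdif[OF cube_codingD(2)[OF R x] cube_codingD(2)[OF R E(2)]] by (simp add: symdif_empty_iff)
  have "gdist S E x z \<le> enat (length [x, z] - 1)"
    by (rule gdist_le_walk) (use x E in auto)
  then have "card (symdif (\<phi> x) (\<phi> z)) \<le> 1" using cube_codingD(3)[OF R x E(2)] by simp
  then have "card (symdif (\<phi> x) (\<phi> z)) = 1" using pos by linarith
  then show thesis using that by (rule symdif_card_1)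
qed

text \<open>The first edge of a shortest walk flips a single coordinate; if it did not separate the
  two ends, the rest of the walk would be too short.\<close>

lemma cube_coding_isometric:
  assumes R: "cube_coding S E \<phi>"
  shows "isometric (\<phi> ` S)"
  unfolding isometric_def
proof (intro conjI ballI impI)
  fix a assume "a \<in> \<phi> ` S"
  then show "finite a" using cube_codingD(2)[OF R] by blast
next
  fix a b assume "a \<in> \<phi> ` S" "b \<in> \<phi> ` S" and ne: "a \<noteq> b"
  then obtain x y where x: "x \<in> S" "a = \<phi> x" and y: "y \<in> S" "b = \<phi> y" by blast
  have fin: "finite (symdif a b)" using finite_symdif cube_codingD(2)[OF R] x y by metis
  then have "card (symdif a b) \<noteq> 0" using ne by (simp add: symdif_empty_iff)
  then obtain n where n: "card (symdif a b) = Suc n" by (meson not0_implies_Suc)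
  then have "gdist S E x y = enat (Suc n)" using cube_codingD(3)[OF R x(1) y(1)] x y by simp
  then obtain xs where xs: "xs \<noteq> []" "hd xs = x" "last xs = y" "set xs \<subseteq> S" "walk E xs" "length xs - 1 = Suc n"
    by (rule gdist_attained)
  then have "length xs = Suc (Suc n)" by simp
  then obtain x' z zs where zs: "xs = x' # z # zs" "length zs = n" by (rule walk_Suc_Suc)
  have z: "E x z" "z \<in> S" "x' = x" using xs zs by auto
  have "gdist S E z y \<le> enat (length (z # zs) - 1)"
    by (rule gdist_le_walk) (use xs zs in auto)
  then have le: "card (symdif (\<phi> z) b) \<le> n" using cube_codingD(3)[OF R z(2) y(1)] y zs by simp
  obtain i where i: "\<phi> z = flip i a" "i \<in> symdif a (\<phi> z)" using cube_coding_step[OF R x(1) z(1,2)] x(2) by metis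
  have "i \<in> symdif a b"
  proof (rule ccontr)
    assume "i \<notin> symdif a b"
    then have "symdif a b \<subseteq> symdif (\<phi> z) b" unfolding i(1) by (auto simp: mem_symdif)
    then have "card (symdif a b) \<le> card (symdif (\<phi> z) b)"
      using finite_symdif cube_codingD(2)[OF R] z y by (metis card_mono)
    then show False using le n by linarith
  qed
  then show "\<exists>i\<in>symdif a b. flip i a \<in> \<phi> ` S" using i(1) z(2) by force
qed

lemma walk_mono:
  assumes "\<And>x y. E x y \<Longrightarrow> E' x y"
  shows "walk E xs \<Longrightarrow> walk E' xs"
  by (induction xs rule: induct_list012) (use assms in auto)

lemma gdist_induced_ge:
  assumes "A \<subseteq> S"
  shows "gdist S E x y \<le> gdist A (induced E A) x y"
proof -
  have "walk (induced E A) xs \<Longrightarrow> walk E xs" for xs by (rule walk_mono) (auto simp: induced_def)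
  then show ?thesis unfolding gdist_def by (intro Inf_superset_mono) (use assms in blast)
qed

lemma graph_induced: "graph S E \<Longrightarrow> graph A (induced E A)"
  by (auto simp: graph_def induced_def)

lemma cube_coding_adjacent:
  assumes R: "cube_coding S E \<phi>" and xy: "x \<in> S" "y \<in> S" and t: "\<phi> y = flip i (\<phi> x)"
  shows "E x y"
proof -
  have "symdif (\<phi> x) (\<phi> y) = {i}" unfolding t by (auto simp: symdif_def)
  then have "gdist S E x y = enat (Suc 0)" using cube_codingD(3)[OF R xy] by simp
  then obtain xs where xs: "xs \<noteq> []" "hd xs = x" "last xs = y" "walk E xs" "length xs - 1 = Suc 0"
    by (rule gdist_attained)
  then have "length xs = Suc (Suc 0)" by simp
  then obtain x' z zs where "xs = x' # z # zs" "length zs = 0" by (rule walk_Suc_Suc)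
  then show ?thesis using xs by auto
qed

lemma cube_coding_induced:
  assumes R: "cube_coding S E \<phi>" and A: "A \<subseteq> S" and isometric: "isometric (\<phi> ` A)"
  shows "cube_coding A (induced E A) \<phi>"
  unfolding cube_coding_def
proof (intro conjI ballI)
  show "graph A (induced E A)" using graph_induced cube_codingD(1)[OF R] .
  show "finite (\<phi> x)" if "x \<in> A" for x using cube_codingD(2)[OF R] A that by blast
  fix x y assume xy: "x \<in> A" "y \<in> A"
  have walk: "\<exists>xs. xs \<noteq> [] \<and> hd xs = x \<and> last xs = y \<and> set xs \<subseteq> A \<and> walk (induced E A) xs \<and> length xs - 1 = n"
    if "x \<in> A" "card (symdif (\<phi> x) (\<phi> y)) = n" for x n
    using that
  proof (induction n arbitrary: x)
    case 0
    have "finite (symdif (\<phi> x) (\<phi> y))" using finite_symdif cube_codingD(2)[OF R] A 0 xy by (metis subsetD)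
    then have "\<phi> x = \<phi> y" using 0 by (simp add: symdif_empty_iff)
    then have "x = y" using cube_coding_inj[OF R] A 0 xy by blast
    then show ?case using 0 by (intro exI[of _ "[x]"]) auto
  next
    case (Suc n)
    have fin: "finite (symdif (\<phi> x) (\<phi> y))" using finite_symdif cube_codingD(2)[OF R] A Suc xy by (metis subsetD)
    have "\<phi> x \<noteq> \<phi> y" using Suc.prems(2) by (auto simp: symdif_def)
    then obtain i where i: "i \<in> symdif (\<phi> x) (\<phi> y)" "flip i (\<phi> x) \<in> \<phi> ` A"
      using isometricD[OF isometric, of "\<phi> x" "\<phi> y"] Suc.prems(1) xy by blast
    then obtain z where z: "z \<in> A" "\<phi> z = flip i (\<phi> x)" by force
    have "symdif (\<phi> z) (\<phi> y) = symdif (\<phi> x) (\<phi> y) - {i}" unfolding z(2) using i(1) by (auto simp: symdif_def)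
    then have "card (symdif (\<phi> z) (\<phi> y)) = n" using Suc.prems(2) fin i(1) by simp
    then obtain xs where xs: "xs \<noteq> []" "hd xs = z" "last xs = y" "set xs \<subseteq> A" "walk (induced E A) xs" "length xs - 1 = n"
      using Suc.IH[OF z(1)] by blast
    have "E x z" using cube_coding_adjacent[OF R _ _ z(2)] A Suc.prems(1) z(1) by blast
    then have "walk (induced E A) (x # xs)" using xs z(1) Suc.prems(1) by (cases xs) (auto simp: induced_def)
    then show ?case using xs Suc.prems(1) by (intro exI[of _ "x # xs"]) (auto simp: Suc_diff_le neq_Nil_conv)
  qed
  have "gdist A (induced E A) x y \<le> enat (card (symdif (\<phi> x) (\<phi> y)))"
    using walk[OF xy(1) refl] gdist_le_walk by metis
  moreover have "enat (card (symdif (\<phi> x) (\<phi> y))) \<le> gdist A (induced E A) x y"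
    using gdist_induced_ge[OF A] cube_codingD(3)[OF R] A xy by (metis subsetD)
  ultimately show "gdist A (induced E A) x y = enat (card (symdif (\<phi> x) (\<phi> y)))" by (rule antisym)
qed

section \<open>Intervals, convexity and pre-hull number in coordinates\<close>

lemma cube_coding_gint:
  assumes R: "cube_coding S E \<phi>" and xy: "x \<in> S" "y \<in> S"
  shows "gint S E x y = {z \<in> S. btw (\<phi> x) (\<phi> z) (\<phi> y)}"
proof -
  have "gdist S E x z + gdist S E z y = gdist S E x y \<longleftrightarrow> btw (\<phi> x) (\<phi> z) (\<phi> y)" if "z \<in> S" for z
    using btw_card_iff[OF cube_codingD(2)[OF R xy(1)] cube_codingD(2)[OF R xy(2)] cube_codingD(2)[OF R that]]
      cube_codingD(3)[OF R xy(1) that] cube_codingD(3)[OF R that xy(2)] cube_codingD(3)[OF R xy] by simp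
  then show ?thesis by (auto simp: gint_def)
qed

lemma cube_coding_gconvex:
  assumes R: "cube_coding S E \<phi>" and A: "A \<subseteq> S"
  shows "gconvex S E A \<longleftrightarrow> convex_in (\<phi> ` S) (\<phi> ` A)"
proof -
  have mem: "\<phi> z \<in> \<phi> ` A \<longleftrightarrow> z \<in> A" if "z \<in> S" for z
    using inj_on_image_mem_iff[OF cube_coding_inj_on[OF R] that A] .
  have gint: "gint S E x y \<subseteq> A \<longleftrightarrow> (\<forall>z\<in>S. btw (\<phi> x) (\<phi> z) (\<phi> y) \<longrightarrow> z \<in> A)" if "x \<in> A" "y \<in> A" for x y
    unfolding cube_coding_gint[OF R subsetD[OF A that(1)] subsetD[OF A that(2)]] by blast
  have "gconvex S E A \<longleftrightarrow> (\<forall>x\<in>A. \<forall>y\<in>A. \<forall>z\<in>S. btw (\<phi> x) (\<phi> z) (\<phi> y) \<longrightarrow> z \<in> A)"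
    unfolding gconvex_def using A gint by (simp cong: ball_cong)
  also have "\<dots> \<longleftrightarrow> convex_in (\<phi> ` S) (\<phi> ` A)"
    unfolding convex_in_def using A by (simp add: mem image_mono cong: ball_cong)
  finally show ?thesis .
qed

lemma vimage_image:
  assumes "D \<subseteq> \<phi> ` S"
  shows "\<phi> ` {x \<in> S. \<phi> x \<in> D} = D"
  using assms by blast

lemma cube_coding_prehull:
  assumes R: "cube_coding S E \<phi>" and ph: "ph_le S E 1"
  shows "prehull_le_1 (\<phi> ` S)"
  unfolding prehull_le_1_def
proof (intro ballI allI impI)
  fix u' C' y'
  assume u': "u' \<in> \<phi> ` S" and y': "y' \<in> \<phi> ` S"
    and C': "convex_in (\<phi> ` S) C' \<and> u' \<notin> C' \<and> (\<forall>D. convex_in (\<phi> ` S) D \<and> C' \<subseteq> D \<and> u' \<notin> D \<longrightarrow> D = C')"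
    and hull: "\<forall>D. convex_in (\<phi> ` S) D \<and> insert u' C' \<subseteq> D \<longrightarrow> y' \<in> D"
  obtain u y where u: "u \<in> S" "u' = \<phi> u" and y: "y \<in> S" "y' = \<phi> y" using u' y' by blast
  define C where "C = {x \<in> S. \<phi> x \<in> C'}"
  have CS: "C \<subseteq> S" by (auto simp: C_def)
  have im: "\<phi> ` C = C'" unfolding C_def using vimage_image convex_in_subset C' by metis
  have mem: "\<phi> z \<in> \<phi> ` A \<longleftrightarrow> z \<in> A" if "z \<in> S" "A \<subseteq> S" for z A
    using inj_on_image_mem_iff[OF cube_coding_inj_on[OF R] that] .
  have "copoint S E u C" unfolding copoint_def
  proof (intro conjI allI impI)
    show "gconvex S E C" using cube_coding_gconvex[OF R CS] im C' by simp
    show "u \<notin> C" using C' u by (auto simp: C_def)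
    fix D assume D: "gconvex S E D \<and> C \<subseteq> D \<and> u \<notin> D"
    then have DS: "D \<subseteq> S" by (auto simp: gconvex_def)
    have "convex_in (\<phi> ` S) (\<phi> ` D)" using cube_coding_gconvex[OF R DS] D by blast
    moreover have "C' \<subseteq> \<phi> ` D" using im D by blast
    moreover have "u' \<notin> \<phi> ` D" using mem[OF u(1) DS] u(2) D by blast
    ultimately have "\<phi> ` D = \<phi> ` C" using C' im by blast
    then show "D = C" using inj_on_image_eq_iff[OF cube_coding_inj_on[OF R] DS CS] by blast
  qed
  then obtain m where m: "m \<le> 1" "cvx_hull S E (insert u C) = (Iset S E ^^ m) (insert u C)"
    using ph u(1) unfolding ph_le_def by blast
  have "y \<in> cvx_hull S E (insert u C)" unfolding cvx_hull_def
  proof (rule InterI)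
    fix B assume "B \<in> {B. gconvex S E B \<and> insert u C \<subseteq> B}"
    then have B: "gconvex S E B" "insert u C \<subseteq> B" "B \<subseteq> S" by (auto simp: gconvex_def)
    then have "convex_in (\<phi> ` S) (\<phi> ` B)" using cube_coding_gconvex[OF R] by blast
    moreover have "insert u' C' \<subseteq> \<phi> ` B" using B(2) im u(2) by blast
    ultimately show "y \<in> B" using hull y mem[OF y(1) B(3)] by blast
  qed
  then have yI: "y \<in> (Iset S E ^^ m) (insert u C)" using m by simp
  have ins: "\<phi> z \<in> insert u' C'" if "z \<in> insert u C" for z using that u(2) im by blast
  show "\<exists>a\<in>insert u' C'. \<exists>b\<in>insert u' C'. btw a y' b"
  \<comment> \<open>The exponent may also be 0; then the vertex is in the set itself and is an end
    of a degenerate interval.\<close>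
  proof (cases "m = 0")
    case True
    then have "\<phi> y \<in> insert u' C'" using yI ins by simp
    then show ?thesis using y btw_refl(1) by blast
  next
    case False
    then have "m = 1" using m by simp
    then obtain a b where ab: "a \<in> insert u C" "b \<in> insert u C" "y \<in> gint S E a b"
      using yI by (auto simp: Iset_def)
    have "a \<in> S" "b \<in> S" using ab CS u by auto
    then have "btw (\<phi> a) y' (\<phi> b)" using cube_coding_gint[OF R] ab(3) y(2) by auto
    then show ?thesis using ins ab by blast
  qed
qed

text \<open>The join of \<open>x\<close> and \<open>C\<close> is convex by the Peano axiom and
  consists of intervals from \<open>x\<close>, so a single interval step already reaches the
  hull.\<close>

lemma peano_ph_le:
  assumes R: "cube_coding S E \<phi>" and P: "peano (\<phi> ` S)"
  shows "ph_le S E 1"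
  unfolding ph_le_def
proof (intro exI[of _ 1] conjI ballI allI impI)
  fix x C assume x: "x \<in> S" and cop: "copoint S E x C"
  then have C: "gconvex S E C" "C \<subseteq> S" by (auto simp: copoint_def gconvex_def)
  define J where "J = {z \<in> S. z = x \<or> (\<exists>c\<in>C. btw (\<phi> x) (\<phi> z) (\<phi> c))}"
  have JS: "J \<subseteq> S" by (auto simp: J_def)
  have xJ: "x \<in> J" using x by (simp add: J_def)
  have im: "\<phi> ` J = {z \<in> \<phi> ` S. z = \<phi> x \<or> (\<exists>c\<in>\<phi> ` C. btw (\<phi> x) z c)}" (is "_ = ?J")
  proof (intro equalityI subsetI)
    show "z \<in> ?J" if "z \<in> \<phi> ` J" for z using that by (auto simp: J_def)
    fix z assume "z \<in> ?J"
    then obtain s where s: "s \<in> S" "z = \<phi> s" and "z = \<phi> x \<or> (\<exists>c\<in>C. btw (\<phi> x) z (\<phi> c))" by blast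
    then have "z = \<phi> x \<or> s \<in> J" by (auto simp: J_def)
    then show "z \<in> \<phi> ` J" using xJ s(2) by blast
  qed
  have "convex_in (\<phi> ` S) (\<phi> ` C)" using cube_coding_gconvex[OF R C(2)] C(1) by blast
  then have "convex_in (\<phi> ` S) (\<phi> ` J)" unfolding im by (rule peano_join_convex[OF P]) (rule imageI[OF x])
  then have J: "gconvex S E J" using cube_coding_gconvex[OF R JS] by blast
  have "c \<in> J" if "c \<in> C" for c
    using that C(2) btw_refl(2)[of "\<phi> x" "\<phi> c"] unfolding J_def by blast
  then have "insert x C \<subseteq> J" using xJ by blast
  then have "cvx_hull S E (insert x C) \<subseteq> J" using J unfolding cvx_hull_def by blast
  also have "J \<subseteq> Iset S E (insert x C)"
  proof
    fix z assume "z \<in> J"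
    then consider "z = x" | c where "z \<in> S" "c \<in> C" "btw (\<phi> x) (\<phi> z) (\<phi> c)" unfolding J_def by blast
    then show "z \<in> Iset S E (insert x C)"
    proof cases
      case 1
      then have "z \<in> gint S E x x" using cube_coding_gint[OF R x x] x by simp
      then show ?thesis unfolding Iset_def by blast
    next
      case 2
      then have "z \<in> gint S E x c" using cube_coding_gint[OF R x subsetD[OF C(2)]] by simp
      then show ?thesis using 2(2) unfolding Iset_def by blast
    qed
  qed
  finally have "cvx_hull S E (insert x C) \<subseteq> Iset S E (insert x C)" .
  moreover have "Iset S E (insert x C) \<subseteq> cvx_hull S E (insert x C)"
  proof -
    have "gint S E p q \<subseteq> B" if "gconvex S E B" "insert x C \<subseteq> B" "p \<in> insert x C" "q \<in> insert x C" for B p q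
      using that unfolding gconvex_def by (meson subsetD)
    then show ?thesis unfolding Iset_def cvx_hull_def by blast
  qed
  ultimately show "cvx_hull S E (insert x C) = (Iset S E ^^ 1) (insert x C)" by simp
qed simp

lemma gconvex_coding_induced:
  assumes R: "cube_coding S E \<phi>" and A: "gconvex S E A"
  shows "cube_coding A (induced E A) \<phi>" "convex_in (\<phi> ` S) (\<phi> ` A)"
proof -
  have AS: "A \<subseteq> S" using A by (simp add: gconvex_def)
  show convex_in: "convex_in (\<phi> ` S) (\<phi> ` A)" using cube_coding_gconvex[OF R AS] A by blast
  show "cube_coding A (induced E A) \<phi>" using cube_coding_induced[OF R AS convex_isometric[OF cube_coding_isometric[OF R] convex_in]] .
qed

lemma ph_le_peano:
  assumes R: "cube_coding S E \<phi>" and ph: "\<And>A. finite A \<Longrightarrow> gconvex S E A \<Longrightarrow> ph_le A (induced E A) 1"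
  shows "peano (\<phi> ` S)"
  unfolding peano_def
proof (intro ballI impI)
  let ?G = "\<phi> ` S"
  fix u v w x y assume G: "u \<in> ?G" "v \<in> ?G" "w \<in> ?G" "x \<in> ?G" "y \<in> ?G" and b: "btw u x w \<and> btw v y x"
  define F where "F = u \<union> v \<union> w"
  define K where "K = {a \<in> ?G. a \<subseteq> F}"
  have "c \<subseteq> F" if "a \<subseteq> F" "a' \<subseteq> F" "btw a c a'" for a a' c
    using that unfolding btw_def by blast
  then have K: "convex_in ?G K" by (auto simp: convex_in_def K_def)
  have "finite F" using G cube_codingD(2)[OF R] by (auto simp: F_def)
  then have finK: "finite K" by (rule finite_subset[rotated, OF finite_Pow_iff[THEN iffD2]]) (auto simp: K_def)
  have "join_hull_commutative K"
  proof (rule prehull_join_hull_commutative[OF finK convex_isometric[OF cube_coding_isometric[OF R] K]])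
    fix A' assume "convex_in K A'"
    then have A': "convex_in ?G A'" "A' \<subseteq> K" using convex_in_trans[OF K] convex_in_subset by blast+
    define A where "A = {x \<in> S. \<phi> x \<in> A'}"
    have AS: "A \<subseteq> S" by (auto simp: A_def)
    have im: "\<phi> ` A = A'" unfolding A_def using vimage_image convex_in_subset[OF A'(1)] .
    have "gconvex S E A" using cube_coding_gconvex[OF R AS] im A' by simp
    moreover have "finite A"
    proof (rule finite_imageD)
      show "finite (\<phi> ` A)" using im A'(2) finK finite_subset by metis
      show "inj_on \<phi> A" using cube_coding_inj_on[OF R] AS inj_on_subset by blast
    qed
    ultimately have "ph_le A (induced E A) 1" "cube_coding A (induced E A) \<phi>"
      using ph gconvex_coding_induced[OF R] by blast+
    then show "prehull_le_1 A'" using cube_coding_prehull im by metis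
  qed
  then have P: "peano K" by (rule join_hull_commutative_peano)
  have mem: "u \<in> K" "v \<in> K" "w \<in> K" using G by (auto simp: K_def F_def)
  have xK: "x \<in> K" using convex_inD[OF K mem(1,3) G(4)] b by blast
  have yK: "y \<in> K" using convex_inD[OF K mem(2) xK G(5)] b by blast
  obtain z where "z \<in> K" "btw v z w" "btw u y z"
    using peanoD[OF P mem xK yK conjunct1[OF b] conjunct2[OF b]] .
  then show "\<exists>z\<in>?G. btw v z w \<and> btw u y z" using convex_in_subset[OF K] by blast
qed

theorem theorem6p4:
  fixes V W :: "'a set" and E :: "'a \<Rightarrow> 'a \<Rightarrow> bool" and f :: "'a \<Rightarrow> 'a"
  assumes "peano_partial_cube V E"
    and "retraction V E W f"
  shows "peano_partial_cube W (induced E W)"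
proof -
  have conn: "connected_graph V E" and
    ph: "\<And>A. finite A \<Longrightarrow> gconvex V E A \<Longrightarrow> ph_le A (induced E A) 1"
    using assms(1) by (auto simp: peano_partial_cube_def partial_cube_def)
  have symdif_Un: "symdif a b = (a - b) \<union> (b - a)" for a b :: "'a set set"
    by (auto simp: symdif_def)
  obtain \<phi> :: "'a \<Rightarrow> 'a set set" where "\<forall>x\<in>V. finite (\<phi> x)"
    "\<forall>x\<in>V. \<forall>y\<in>V. gdist V E x y = enat (card (symdif (\<phi> x) (\<phi> y)))"
    using assms(1) unfolding peano_partial_cube_def partial_cube_def symdif_Un by blast
  then have R: "cube_coding V E \<phi>" using conn by (simp add: cube_coding_def connected_graph_def)
  have WV: "W \<subseteq> V" and fW: "\<And>x. x \<in> V \<Longrightarrow> f x \<in> W" and f_id: "\<And>x. x \<in> W \<Longrightarrow> f x = x"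
    and f_dist: "\<And>x y. x \<in> V \<Longrightarrow> y \<in> V \<Longrightarrow> gdist W (induced E W) (f x) (f y) \<le> gdist V E x y"
    using assms(2) by (auto simp: retraction_def)
  have RW: "cube_coding W (induced E W) \<phi>" unfolding cube_coding_def
  proof (intro conjI ballI)
    show "graph W (induced E W)" using graph_induced cube_codingD(1)[OF R] .
    show "finite (\<phi> x)" if "x \<in> W" for x using cube_codingD(2)[OF R] WV that by blast
    fix x y assume xy: "x \<in> W" "y \<in> W"
    \<comment> \<open>A contraction that fixes \<open>W\<close> makes \<open>W\<close> isometric in
      \<open>V\<close>, so the coordinates of \<open>V\<close> also serve for
      \<open>W\<close>.\<close>
    then have "gdist W (induced E W) x y \<le> gdist V E x y" using f_dist[of x y] f_id WV by auto
    then have "gdist W (induced E W) x y = gdist V E x y" using gdist_induced_ge[OF WV] by (rule antisym)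
    then show "gdist W (induced E W) x y = enat (card (symdif (\<phi> x) (\<phi> y)))"
      using cube_codingD(3)[OF R] xy WV by auto
  qed
  define \<rho> where "\<rho> = (\<lambda>c. \<phi> (f (the_inv_into V \<phi> c)))"
  have \<rho>: "\<rho> (\<phi> x) = \<phi> (f x)" if "x \<in> V" for x
    using the_inv_into_f_f[OF cube_coding_inj_on[OF R] that] by (simp add: \<rho>_def)
  interpret family_retract "\<phi> ` V" "\<phi> ` W" \<rho>
  proof
    show "isometric (\<phi> ` V)" "isometric (\<phi> ` W)" using cube_coding_isometric R RW by blast+
    show "peano (\<phi> ` V)" using ph_le_peano[OF R ph] .
    show "\<phi> ` W \<subseteq> \<phi> ` V" using WV by blast
    show "\<rho> c \<in> \<phi> ` W" if "c \<in> \<phi> ` V" for c using that \<rho> fW by auto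
    show "\<rho> a = a" if "a \<in> \<phi> ` W" for a using that \<rho> f_id WV by auto
    fix a b assume "a \<in> \<phi> ` V" "b \<in> \<phi> ` V"
    then obtain x y where x: "x \<in> V" "a = \<phi> x" and y: "y \<in> V" "b = \<phi> y" by blast
    show "card (symdif (\<rho> a) (\<rho> b)) \<le> card (symdif a b)"
      using f_dist[OF x(1) y(1)] cube_codingD(3)[OF R x(1) y(1)] cube_codingD(3)[OF RW fW[OF x(1)] fW[OF y(1)]] \<rho> x y
      by simp
  qed
  have "ph_le A (induced (induced E W) A) 1" if "gconvex W (induced E W) A" for A
    using peano_ph_le[OF gconvex_coding_induced(1)[OF RW that]
        convex_peano[OF retract_peano gconvex_coding_induced(2)[OF RW that]]] .
  moreover have "partial_cube W (induced E W)"
    unfolding partial_cube_def connected_graph_def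
  proof (intro conjI exI[of _ \<phi>] ballI)
    show "gdist W (induced E W) x y = enat (card ((\<phi> x - \<phi> y) \<union> (\<phi> y - \<phi> x)))" if "x \<in> W" "y \<in> W" for x y
      using cube_codingD(3)[OF RW that] by (simp add: symdif_Un)
    show "gdist W (induced E W) x y < \<infinity>" if "x \<in> W" "y \<in> W" for x y
      using cube_codingD(3)[OF RW that] by simp
  qed (use cube_codingD[OF RW] in auto)
  ultimately show ?thesis by (simp add: peano_partial_cube_def)
qed

end
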